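(* There is a universal constant $A>0$ such that for every integer $n>0$ and every integer $k$ with $2\le k\le 2^n$, there is a quantum learner that exactly learns the concept class $$\mathcal{C}=\{f:\{0,1\}^n\to\{-1,1\} : |\mathrm{supp}(\widehat f)|\le k\}$$ of $k$-Fourier-sparse Boolean functions with success probability at least $2/3$, using at most $A\,k^{1.5}(\log k)^2$ uniform quantum examples. (That is, $O(k^{1.5}(\log k)^2)$ uniform quantum examples suffice to learn $\mathcal{C}$ with probability $\ge 2/3$.)
   Context: Logarithms are base 2. For $f:\{0,1\}^n\to\mathbb{R}$ and $S\in\{0,1\}^n$, the Fourier coefficient is $\widehat f(S)=2^{-n}\sum_{x\in\{0,1\}^n} f(x)(-1)^{S\cdot x}$, where $S\cdot x=\sum_i S_ix_i$. The Fourier support is $\mathrm{supp}(\widehat f)=\{S:\widehat f(S)\ne 0\}$. A uniform quantum example for $c:\{0,1\}^n\to\{-1,1\}$ is the $(n+1)$-qubit state $|\psi_c\rangle=\frac{1}{\sqrt{2^n}}\sum_{x\in\{0,1\}^n}|x,c(x)\rangle$, where $\{|x,b\rangle : x\in\{0,1\}^n,\ b\in\{-1,1\}\}$ is an orthonormal basis. A quantum learner using $T$ uniform quantum examples is a quantum measurement (POVM) applied to $|\psi_c\rangle^{\otimes T}$, not depending on $c$, whose outcome is a function $h:\{0,1\}^n\to\{-1,1\}$. It exactly learns the class $\mathcal{C}$ with success probability at least $p$ if for every $c\in\mathcal{C}$ the outcome equals $c$ with probability at least $p$. The learner knows $n$ and $k$. *)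

theory Defs
  imports Complex_Main "HOL-Library.FuncSet" "HOL-Library.Nonpos_Ints"
begin

section \<open>Boolean functions and their Fourier support\<close>

text \<open>Points of the cube are extensional functions, so that every element of
  \<open>{0,1}\<^sup>n\<close>, and every function defined on it, has exactly one representation.\<close>

definition cube :: "nat \<Rightarrow> (nat \<Rightarrow> nat) set" where
  "cube n = {..<n} \<rightarrow>\<^sub>E {0, 1}"

definition boolean_functions :: "nat \<Rightarrow> ((nat \<Rightarrow> nat) \<Rightarrow> real) set" where
  "boolean_functions n = cube n \<rightarrow>\<^sub>E {-1, 1}"

definition fourier_coeff :: "nat \<Rightarrow> ((nat \<Rightarrow> nat) \<Rightarrow> real) \<Rightarrow> (nat \<Rightarrow> nat) \<Rightarrow> real" where
  "fourier_coeff n f S = (1 / 2 ^ n) * (\<Sum>x\<in>cube n. f x * (-1) ^ (\<Sum>i<n. S i * x i))"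

definition fourier_support :: "nat \<Rightarrow> ((nat \<Rightarrow> nat) \<Rightarrow> real) \<Rightarrow> (nat \<Rightarrow> nat) set" where
  "fourier_support n f = {S \<in> cube n. fourier_coeff n f S \<noteq> 0}"

definition fourier_sparse :: "nat \<Rightarrow> nat \<Rightarrow> ((nat \<Rightarrow> nat) \<Rightarrow> real) set" where
  "fourier_sparse n k = {f \<in> boolean_functions n. card (fourier_support n f) \<le> k}"

section \<open>Measurements on the Hilbert space with a given finite orthonormal basis\<close>

text \<open>For a finite set \<open>B\<close> of basis labels, a vector of \<open>\<complex>\<^sup>B\<close> is given by its
  coordinates, and an operator by its matrix entries \<open>M i j = \<langle>i|M|j\<rangle>\<close>. Only arguments
  in \<open>B\<close> matter.\<close>

definition quad_form :: "'i set \<Rightarrow> ('i \<Rightarrow> 'i \<Rightarrow> complex) \<Rightarrow> ('i \<Rightarrow> complex) \<Rightarrow> complex" where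
  "quad_form B M v = (\<Sum>i\<in>B. \<Sum>j\<in>B. cnj (v i) * M i j * v j)"

text \<open>Over the complex numbers, a nonnegative real quadratic form forces \<open>M\<close> to be
  Hermitian, so no separate condition is needed.\<close>

definition psd :: "'i set \<Rightarrow> ('i \<Rightarrow> 'i \<Rightarrow> complex) \<Rightarrow> bool" where
  "psd B M \<longleftrightarrow> (\<forall>v. quad_form B M v \<in> \<real>\<^sub>\<ge>\<^sub>0)"

text \<open>A POVM with finite outcome set \<open>Y\<close>: positive semidefinite effects that sum to the
  identity.\<close>

definition povm :: "'i set \<Rightarrow> 'y set \<Rightarrow> ('y \<Rightarrow> 'i \<Rightarrow> 'i \<Rightarrow> complex) \<Rightarrow> bool" where
  "povm B Y E \<longleftrightarrow>
     finite B \<and> finite Y \<and> (\<forall>y\<in>Y. psd B (E y)) \<and>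
     (\<forall>i\<in>B. \<forall>j\<in>B. (\<Sum>y\<in>Y. E y i j) = (if i = j then 1 else 0))"

text \<open>The Born rule for a unit vector \<open>v\<close>; the quadratic form of an effect is real.\<close>

definition outcome_prob ::
  "'i set \<Rightarrow> ('y \<Rightarrow> 'i \<Rightarrow> 'i \<Rightarrow> complex) \<Rightarrow> ('i \<Rightarrow> complex) \<Rightarrow> 'y \<Rightarrow> real" where
  "outcome_prob B E v y = Re (quad_form B (E y) v)"

section \<open>Uniform quantum examples and learners\<close>

definition ket :: "'i \<Rightarrow> 'i \<Rightarrow> complex" where
  "ket i = (\<lambda>j. if j = i then 1 else 0)"

definition example_basis :: "nat \<Rightarrow> ((nat \<Rightarrow> nat) \<times> real) set" where
  "example_basis n = cube n \<times> {-1, 1}"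

definition uniform_example ::
  "nat \<Rightarrow> ((nat \<Rightarrow> nat) \<Rightarrow> real) \<Rightarrow> (nat \<Rightarrow> nat) \<times> real \<Rightarrow> complex" where
  "uniform_example n c = (\<lambda>i. complex_of_real (1 / sqrt (2 ^ n)) * (\<Sum>x\<in>cube n. ket (x, c x) i))"

text \<open>The \<open>T\<close>-fold tensor power of \<open>\<complex>\<^sup>B\<close> has as basis the \<open>T\<close>-tuples of elements of \<open>B\<close>;
  the coordinates of a product vector are the products of the coordinates.\<close>

definition tensor_basis :: "nat \<Rightarrow> 'i set \<Rightarrow> (nat \<Rightarrow> 'i) set" where
  "tensor_basis T B = {..<T} \<rightarrow>\<^sub>E B"

definition tensor_power :: "nat \<Rightarrow> ('i \<Rightarrow> complex) \<Rightarrow> (nat \<Rightarrow> 'i) \<Rightarrow> complex" where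
  "tensor_power T v = (\<lambda>b. \<Prod>t<T. v (b t))"

definition quantum_learner ::
  "nat \<Rightarrow> nat \<Rightarrow> (((nat \<Rightarrow> nat) \<Rightarrow> real) \<Rightarrow>
      (nat \<Rightarrow> (nat \<Rightarrow> nat) \<times> real) \<Rightarrow> (nat \<Rightarrow> (nat \<Rightarrow> nat) \<times> real) \<Rightarrow> complex) \<Rightarrow> bool" where
  "quantum_learner n T E \<longleftrightarrow>
     povm (tensor_basis T (example_basis n)) (boolean_functions n) E"

definition exactly_learns ::
  "nat \<Rightarrow> nat \<Rightarrow> (((nat \<Rightarrow> nat) \<Rightarrow> real) \<Rightarrow>
      (nat \<Rightarrow> (nat \<Rightarrow> nat) \<times> real) \<Rightarrow> (nat \<Rightarrow> (nat \<Rightarrow> nat) \<times> real) \<Rightarrow> complex) \<Rightarrow>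
    ((nat \<Rightarrow> nat) \<Rightarrow> real) set \<Rightarrow> real \<Rightarrow> bool" where
  "exactly_learns n T E C p \<longleftrightarrow>
     (\<forall>c\<in>C. outcome_prob (tensor_basis T (example_basis n)) E
               (tensor_power T (uniform_example n c)) c \<ge> p)"

end

theory Submission
  imports Defs "HOL-Analysis.Convex"
begin

text \<open>
  Half of the registers are measured in the Fourier basis, which samples characters \<open>S\<close> of \<open>c\<close>
  with probability proportional to their squared coefficients, and half in the computational basis, which gives
  labelled examples. The learner outputs a sparse function that is consistent with the examples
  and whose Fourier support lies in the span of the sampled characters.

  Both possible failures are events attached to functions \<open>g\<close> with values in \<open>{-1, 0, 1}\<close> and at
  most \<open>2k\<close> Fourier coefficients in the span \<open>W\<close> of the support of \<open>c\<close>: half the difference of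
  \<open>c\<close> and a translate of \<open>c\<close> for the first half, of \<open>c\<close> and another candidate for the second.
  For \<open>g\<close> of density \<open>d\<close> the event has probability at most \<open>exp(-dm/2)\<close>, where \<open>m\<close> is the number
  of registers in each half. Sparsity bounds the \<open>l\<^sub>1\<close>-norm of the coefficients of \<open>g\<close>,
  so \<open>g\<close> is determined by a short sum of characters (Maurey), which
  bounds the number of such \<open>g\<close> by \<open>|W|\<close> to the power \<open>O(dk log k)\<close>. Hence \<open>m = O(k log k log |W|)\<close>
  suffices in a union bound.

  Finally \<open>log |W| = O(sqrt k log k)\<close> by Sanyal's theorem: some restriction of \<open>c\<close> to a coset of
  the annihilator of a subspace has many nonconstant characters, folding pairs of large
  coefficients makes it constant after few steps, and this merges these characters in pairs.
\<close>

section \<open>Fourier analysis on a finite elementary abelian 2-group\<close>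

lemma exp_le_quadratic:
  fixes x :: real
  assumes "\<bar>x\<bar> \<le> 1"
  shows "exp x \<le> 1 + x + x\<^sup>2"
proof (cases "x \<ge> 0")
  case True
  then show ?thesis using exp_bound[of x] assms by simp
next
  case False
  define y where "y = - x"
  have y: "0 < y" "y \<le> 1" using False assms by (auto simp: y_def)
  \<comment> \<open>The product equals \<open>1 + y^3\<close>.\<close>
  have "1 \<le> (1 + y) * (1 - y + y\<^sup>2)"
    using y by (simp add: power2_eq_square algebra_simps)
  also have "\<dots> \<le> exp y * (1 - y + y\<^sup>2)"
  proof (rule mult_right_mono)
    show "1 + y \<le> exp y" by (rule exp_ge_add_one_self)
    show "0 \<le> 1 - y + y\<^sup>2" using y by (simp add: add_nonneg_nonneg)
  qed
  finally have "exp (- y) \<le> 1 - y + y\<^sup>2"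
    by (simp add: exp_minus field_simps)
  then show ?thesis by (simp add: y_def)
qed

lemma sum_squared_le_card:
  fixes f :: "'a \<Rightarrow> real"
  assumes "card A \<le> k"
  shows "(\<Sum>x\<in>A. f x)\<^sup>2 \<le> real k * (\<Sum>x\<in>A. (f x)\<^sup>2)"
proof -
  have "(\<Sum>x\<in>A. f x)\<^sup>2 \<le> real (card A) * (\<Sum>x\<in>A. (f x)\<^sup>2)"
    using Cauchy_Schwarz_ineq_sum[of "\<lambda>_. 1" f A] by simp
  also have "\<dots> \<le> real k * (\<Sum>x\<in>A. (f x)\<^sup>2)"
    using assms by (intro mult_right_mono sum_nonneg) auto
  finally show ?thesis .
qed

text \<open>The nondegenerate symmetric pairing \<open>chi\<close> identifies the group with its own
  dual, so points and characters are elements of the same set \<open>G\<close>. Working abstractly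
  also lets quotients of the dual be realised as homomorphisms of \<open>G\<close>.\<close>

locale walsh_group =
  fixes G :: "'a set"
    and add :: "'a \<Rightarrow> 'a \<Rightarrow> 'a"  (infixl "\<oplus>" 65)
    and zero :: 'a  ("\<zero>")
    and chi :: "'a \<Rightarrow> 'a \<Rightarrow> real"
  assumes finite_G [simp, intro]: "finite G"
    and zero_in [simp, intro]: "\<zero> \<in> G"
    and add_in [simp, intro]: "x \<in> G \<Longrightarrow> y \<in> G \<Longrightarrow> x \<oplus> y \<in> G"
    and add_assoc: "x \<in> G \<Longrightarrow> y \<in> G \<Longrightarrow> z \<in> G \<Longrightarrow> x \<oplus> y \<oplus> z = x \<oplus> (y \<oplus> z)"
    and add_comm: "x \<in> G \<Longrightarrow> y \<in> G \<Longrightarrow> x \<oplus> y = y \<oplus> x"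
    and add_zero [simp]: "x \<in> G \<Longrightarrow> x \<oplus> \<zero> = x"
    and add_self [simp]: "x \<in> G \<Longrightarrow> x \<oplus> x = \<zero>"
    and chi_comm: "x \<in> G \<Longrightarrow> y \<in> G \<Longrightarrow> chi x y = chi y x"
    and chi_add_left: "x \<in> G \<Longrightarrow> y \<in> G \<Longrightarrow> z \<in> G \<Longrightarrow> chi (x \<oplus> y) z = chi x z * chi y z"
    and chi_cases: "x \<in> G \<Longrightarrow> y \<in> G \<Longrightarrow> chi x y = 1 \<or> chi x y = -1"
    and chi_separates: "x \<in> G \<Longrightarrow> x \<noteq> \<zero> \<Longrightarrow> \<exists>y\<in>G. chi x y = -1"
begin

abbreviation N :: real where "N \<equiv> real (card G)"

lemma N_pos [simp]: "N > 0"
  using finite_G zero_in card_gt_0_iff by (metis empty_iff of_nat_0_less_iff)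

lemma N_nz [simp]: "N \<noteq> 0" using N_pos by linarith

lemma G_nonempty [simp]: "G \<noteq> {}" using zero_in by blast

lemma zero_add [simp]: "x \<in> G \<Longrightarrow> \<zero> \<oplus> x = x"
  by (metis add_comm add_zero zero_in)

lemma add_left_comm: "x \<in> G \<Longrightarrow> y \<in> G \<Longrightarrow> z \<in> G \<Longrightarrow> x \<oplus> (y \<oplus> z) = y \<oplus> (x \<oplus> z)"
  by (metis add_assoc add_comm)

lemmas add_ac = add_assoc add_comm add_left_comm

lemma add_cancel [simp]: "x \<in> G \<Longrightarrow> y \<in> G \<Longrightarrow> x \<oplus> (x \<oplus> y) = y"
  by (metis add_assoc add_self zero_add)

lemma add_cancel_right [simp]: "x \<in> G \<Longrightarrow> y \<in> G \<Longrightarrow> x \<oplus> y \<oplus> y = x"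
  by (simp add: add_assoc)

lemma add_eq_zero_iff [simp]: "x \<in> G \<Longrightarrow> y \<in> G \<Longrightarrow> x \<oplus> y = \<zero> \<longleftrightarrow> x = y"
  by (metis add_cancel add_self add_zero)

lemma zero_eq_add_iff [simp]: "x \<in> G \<Longrightarrow> y \<in> G \<Longrightarrow> \<zero> = x \<oplus> y \<longleftrightarrow> x = y"
  using add_eq_zero_iff by metis

lemma chi_add_right: "x \<in> G \<Longrightarrow> y \<in> G \<Longrightarrow> z \<in> G \<Longrightarrow> chi x (y \<oplus> z) = chi x y * chi x z"
  by (simp add: chi_comm[of x] chi_add_left)

lemma chi_zero_left [simp]: "x \<in> G \<Longrightarrow> chi \<zero> x = 1"
  using chi_add_left[of \<zero> \<zero> x] chi_cases[of \<zero> x] by auto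

lemma chi_zero_right [simp]: "x \<in> G \<Longrightarrow> chi x \<zero> = 1"
  by (simp add: chi_comm[of x \<zero>])

lemma chi_square [simp]: "x \<in> G \<Longrightarrow> y \<in> G \<Longrightarrow> chi x y * chi x y = 1"
  using chi_cases[of x y] by auto

lemma abs_chi [simp]: "x \<in> G \<Longrightarrow> y \<in> G \<Longrightarrow> \<bar>chi x y\<bar> = 1"
  using chi_cases[of x y] by auto

lemma sum_translate: "y \<in> G \<Longrightarrow> (\<Sum>x\<in>G. f (x \<oplus> y)) = (\<Sum>x\<in>G. f x)"
  by (rule sum.reindex_bij_witness[of _ "\<lambda>x. x \<oplus> y" "\<lambda>x. x \<oplus> y"]) auto

lemma sum_translate': "y \<in> G \<Longrightarrow> (\<Sum>x\<in>G. f (y \<oplus> x)) = (\<Sum>x\<in>G. f x)"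
  by (rule sum.reindex_bij_witness[of _ "\<lambda>x. y \<oplus> x" "\<lambda>x. y \<oplus> x"]) auto

text \<open>Translating by a \<open>z\<close> with \<open>chi x z = -1\<close> permutes the terms
  and negates the sum.\<close>

lemma sum_chi:
  assumes "x \<in> G"
  shows "(\<Sum>y\<in>G. chi x y) = (if x = \<zero> then N else 0)"
proof (cases "x = \<zero>")
  case True
  then show ?thesis by simp
next
  case False
  then obtain z where z: "z \<in> G" "chi x z = -1" using chi_separates assms by blast
  have "(\<Sum>y\<in>G. chi x y) = (\<Sum>y\<in>G. chi x (y \<oplus> z))"
    using sum_translate[OF z(1), of "chi x"] by simp
  also have "\<dots> = - (\<Sum>y\<in>G. chi x y)"
    using z assms by (simp add: chi_add_right sum_negf)
  finally show ?thesis using False by simp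
qed

lemma sum_chi_chi:
  assumes "x \<in> G" "y \<in> G"
  shows "(\<Sum>z\<in>G. chi x z * chi y z) = (if x = y then N else 0)"
proof -
  have "(\<Sum>z\<in>G. chi x z * chi y z) = (\<Sum>z\<in>G. chi (x \<oplus> y) z)"
    using assms by (simp add: chi_add_left)
  then show ?thesis using assms by (simp add: sum_chi)
qed

section \<open>The Fourier transform, its inverse, and Parseval\<close>

definition coeff :: "('a \<Rightarrow> real) \<Rightarrow> 'a \<Rightarrow> real" where
  "coeff f S = (\<Sum>x\<in>G. f x * chi S x) / N"

text \<open>The inverse transform. A function called \<open>p\<close> below is a spectrum: its
  argument is read as a character.\<close>

definition synth :: "('a \<Rightarrow> real) \<Rightarrow> 'a \<Rightarrow> real" where
  "synth p x = (\<Sum>S\<in>G. p S * chi S x)"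

lemma synth_coeff:
  assumes "x \<in> G"
  shows "synth (coeff f) x = f x"
proof -
  have "synth (coeff f) x = (\<Sum>S\<in>G. \<Sum>y\<in>G. f y * (chi x S * chi y S) / N)"
    using assms unfolding synth_def coeff_def sum_divide_distrib sum_distrib_right
    by (intro sum.cong refl) (simp add: chi_comm)
  also have "\<dots> = (\<Sum>y\<in>G. f y * (\<Sum>S\<in>G. chi x S * chi y S) / N)"
    by (subst sum.swap) (simp add: sum_distrib_left sum_divide_distrib)
  also have "\<dots> = (\<Sum>y\<in>G. if y = x then f x else 0)"
    using assms by (intro sum.cong refl) (auto simp: sum_chi_chi)
  finally show ?thesis using assms by simp
qed

lemma coeff_synth:
  assumes "S \<in> G"
  shows "coeff (synth p) S = p S"
proof -
  have "(\<Sum>x\<in>G. synth p x * chi S x) = (\<Sum>x\<in>G. \<Sum>T\<in>G. p T * (chi T x * chi S x))"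
    unfolding synth_def by (simp add: sum_distrib_right mult.assoc)
  also have "\<dots> = (\<Sum>T\<in>G. p T * (\<Sum>x\<in>G. chi T x * chi S x))"
    by (subst sum.swap) (simp add: sum_distrib_left)
  also have "\<dots> = (\<Sum>T\<in>G. if T = S then p S * N else 0)"
    using assms by (intro sum.cong refl) (auto simp: sum_chi_chi)
  finally show ?thesis using assms by (simp add: coeff_def)
qed

lemma plancherel: "(\<Sum>S\<in>G. p S * coeff g S) = (\<Sum>x\<in>G. synth p x * g x) / N"
proof -
  have "(\<Sum>S\<in>G. p S * coeff g S) = (\<Sum>S\<in>G. \<Sum>x\<in>G. p S * chi S x * g x / N)"
    unfolding coeff_def by (simp add: sum_distrib_left sum_divide_distrib mult_ac)
  also have "\<dots> = (\<Sum>x\<in>G. \<Sum>S\<in>G. p S * chi S x * g x / N)"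
    by (rule sum.swap)
  also have "\<dots> = (\<Sum>x\<in>G. synth p x * g x) / N"
    unfolding synth_def by (simp add: sum_distrib_right sum_divide_distrib)
  finally show ?thesis .
qed

lemma coeff_cong: "(\<And>x. x \<in> G \<Longrightarrow> f x = g x) \<Longrightarrow> coeff f S = coeff g S"
  unfolding coeff_def by simp

lemma parseval_synth: "(\<Sum>S\<in>G. (p S)\<^sup>2) = (\<Sum>x\<in>G. (synth p x)\<^sup>2) / N"
proof -
  have "(\<Sum>S\<in>G. (p S)\<^sup>2) = (\<Sum>S\<in>G. p S * coeff (synth p) S)"
    by (simp add: coeff_synth power2_eq_square)
  then show ?thesis by (simp add: plancherel power2_eq_square)
qed

lemma parseval: "(\<Sum>S\<in>G. (coeff f S)\<^sup>2) = (\<Sum>x\<in>G. (f x)\<^sup>2) / N"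
  by (simp add: parseval_synth[of "coeff f"] synth_coeff)

lemma coeff_diff: "coeff (\<lambda>x. f x - g x) S = coeff f S - coeff g S"
  by (simp add: coeff_def left_diff_distrib sum_subtractf diff_divide_distrib)

lemma coeff_scale: "coeff (\<lambda>x. a * f x) S = a * coeff f S"
  by (simp add: coeff_def sum_distrib_left mult_ac)

lemma coeff_translate:
  assumes "z \<in> G" "S \<in> G"
  shows "coeff (\<lambda>x. f (x \<oplus> z)) S = chi S z * coeff f S"
proof -
  have "(\<Sum>x\<in>G. f (x \<oplus> z) * chi S x) = (\<Sum>x\<in>G. f (x \<oplus> z) * (chi S (x \<oplus> z) * chi S z))"
    using assms by (intro sum.cong refl) (simp add: chi_add_right)
  also have "\<dots> = (\<Sum>x\<in>G. f x * (chi S x * chi S z))"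
    using sum_translate[OF assms(1), of "\<lambda>x. f x * (chi S x * chi S z)"] by simp
  finally show ?thesis
    by (simp add: coeff_def sum_distrib_left sum_distrib_right mult_ac)
qed

section \<open>Sparsity and the uncertainty principle\<close>

definition supp :: "('a \<Rightarrow> real) \<Rightarrow> 'a set" where
  "supp p = {S \<in> G. p S \<noteq> 0}"

lemma finite_supp [simp, intro]: "finite (supp p)" by (simp add: supp_def)

lemma supp_subset: "supp p \<subseteq> G" by (auto simp: supp_def)

lemma abs_synth_le:
  assumes "x \<in> G"
  shows "\<bar>synth p x\<bar> \<le> (\<Sum>S\<in>G. \<bar>p S\<bar>)"
  unfolding synth_def
  by (rule order.trans[OF sum_abs]) (use assms in \<open>simp add: abs_mult\<close>)

lemma l1_squared_le:
  assumes "card (supp p) \<le> k"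
  shows "(\<Sum>S\<in>G. \<bar>p S\<bar>)\<^sup>2 \<le> real k * (\<Sum>S\<in>G. (p S)\<^sup>2)"
proof -
  have "(\<Sum>S\<in>G. \<bar>p S\<bar>) = (\<Sum>S\<in>supp p. \<bar>p S\<bar>)" "(\<Sum>S\<in>G. (p S)\<^sup>2) = (\<Sum>S\<in>supp p. \<bar>p S\<bar>\<^sup>2)"
    by (auto simp: supp_def intro!: sum.mono_neutral_right)
  then show ?thesis using sum_squared_le_card[OF assms] by metis
qed

text \<open>By Cauchy-Schwarz, every value of \<open>synth p\<close> has square at most
  \<open>k\<close> times the energy \<open>s\<close> of \<open>p\<close>. By Parseval the squares
  add up to \<open>N * s\<close>, so at least \<open>N / k\<close> points must carry them.\<close>

lemma uncertainty_synth:
  assumes k: "card (supp p) \<le> k" and nz: "\<exists>S\<in>G. p S \<noteq> 0"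
  shows "N \<le> real k * real (card {x \<in> G. synth p x \<noteq> 0})"
proof -
  let ?Z = "{x \<in> G. synth p x \<noteq> 0}"
  define s where "s = (\<Sum>S\<in>G. (p S)\<^sup>2)"
  have spos: "s > 0"
  proof -
    obtain S where "S \<in> G" "p S \<noteq> 0" using nz by blast
    then have "0 < (p S)\<^sup>2" "(p S)\<^sup>2 \<le> s"
      unfolding s_def by (auto intro!: member_le_sum)
    then show ?thesis by linarith
  qed
  have "(synth p x)\<^sup>2 \<le> real k * s" if "x \<in> G" for x
  proof -
    have "(synth p x)\<^sup>2 = \<bar>synth p x\<bar>\<^sup>2" by simp
    also have "\<dots> \<le> (\<Sum>S\<in>G. \<bar>p S\<bar>)\<^sup>2"
      using abs_synth_le[OF that] by (intro power_mono) auto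
    finally show ?thesis using l1_squared_le[OF k] by (simp add: s_def)
  qed
  then have "(\<Sum>x\<in>?Z. (synth p x)\<^sup>2) \<le> real (card ?Z) * (real k * s)"
    by (intro sum_bounded_above) auto
  moreover have "(\<Sum>x\<in>?Z. (synth p x)\<^sup>2) = (\<Sum>x\<in>G. (synth p x)\<^sup>2)"
    by (rule sum.mono_neutral_left) auto
  moreover have "(\<Sum>x\<in>G. (synth p x)\<^sup>2) = N * s"
    by (simp add: s_def parseval_synth[of p])
  ultimately have "N * s \<le> (real k * real (card ?Z)) * s" by (simp add: mult_ac)
  then show ?thesis using spos by simp
qed

lemma uncertainty:
  assumes "card (supp (coeff f)) \<le> k" and "\<exists>x\<in>G. f x \<noteq> 0"
  shows "N \<le> real k * real (card {x \<in> G. f x \<noteq> 0})"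
proof -
  have "\<exists>S\<in>G. coeff f S \<noteq> 0"
  proof (rule ccontr)
    assume "\<not> ?thesis"
    then have "synth (coeff f) x = 0" for x by (simp add: synth_def)
    then show False using assms(2) synth_coeff by metis
  qed
  then have "N \<le> real k * real (card {x \<in> G. synth (coeff f) x \<noteq> 0})"
    using assms(1) uncertainty_synth by blast
  moreover have "{x \<in> G. synth (coeff f) x \<noteq> 0} = {x \<in> G. f x \<noteq> 0}"
    by (auto simp: synth_coeff)
  ultimately show ?thesis by simp
qed

section \<open>Subgroups and double annihilators\<close>

definition subgrp :: "'a set \<Rightarrow> bool" where
  "subgrp W \<longleftrightarrow> W \<subseteq> G \<and> \<zero> \<in> W \<and> (\<forall>x\<in>W. \<forall>y\<in>W. x \<oplus> y \<in> W)"

text \<open>A subgroup equals its double annihilator: the indicator of \<open>W\<close> has its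
  spectrum in the annihilator of \<open>W\<close>, where \<open>S\<close> is trivial, so inversion
  gives the same value at \<open>S\<close> as at zero.\<close>

lemma subgrp_separates:
  assumes W: "subgrp W" and S: "S \<in> G"
    and triv: "\<And>z. z \<in> G \<Longrightarrow> (\<And>w. w \<in> W \<Longrightarrow> chi w z = 1) \<Longrightarrow> chi S z = 1"
  shows "S \<in> W"
proof -
  define f where "f x = (if x \<in> W then 1 else 0 :: real)" for x
  have WG: "W \<subseteq> G" and W0: "\<zero> \<in> W" and Wadd: "\<And>x y. x \<in> W \<Longrightarrow> y \<in> W \<Longrightarrow> x \<oplus> y \<in> W"
    using W by (auto simp: subgrp_def)
  \<comment> \<open>The indicator is invariant under translation by \<open>w\<close>, while its
    coefficient at \<open>z\<close> changes sign.\<close>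
  have c0: "coeff f z = 0" if z: "z \<in> G" and w: "w \<in> W" "chi w z \<noteq> 1" for z w
  proof -
    have wG: "w \<in> G" using w WG by auto
    have m1: "chi z w = -1" using chi_cases[OF wG z] w(2) chi_comm[OF wG z] by auto
    have inv: "f (x \<oplus> w) = f x" if "x \<in> G" for x
      using Wadd[OF _ w(1)] add_cancel_right[OF that wG] unfolding f_def by metis
    have "coeff f z = coeff (\<lambda>x. f (x \<oplus> w)) z"
      by (rule coeff_cong) (simp add: inv)
    also have "\<dots> = - coeff f z" using coeff_translate[OF wG z] m1 by simp
    finally show ?thesis by simp
  qed
  have "f S = synth (coeff f) S" using S by (simp add: synth_coeff)
  also have "\<dots> = synth (coeff f) \<zero>"
    unfolding synth_def
  proof (rule sum.cong[OF refl])
    fix z assume z: "z \<in> G"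
    show "coeff f z * chi z S = coeff f z * chi z \<zero>"
    proof (cases "\<forall>w\<in>W. chi w z = 1")
      case True
      then have "chi S z = 1" using triv z by blast
      then show ?thesis using z S by (simp add: chi_comm[OF z S])
    next
      case False
      then show ?thesis using c0[OF z] by auto
    qed
  qed
  also have "\<dots> = f \<zero>" by (simp add: synth_coeff)
  finally show ?thesis using W0 by (auto simp: f_def split: if_splits)
qed

end

section \<open>Folding Fourier coefficients\<close>

text \<open>If \<open>u\<close> and \<open>v\<close> have opposite signs, the left side is twice the
  product of \<open>\<bar>u\<bar>\<close> and \<open>\<bar>v\<bar>\<close> and the bracket on the
  right is twice their minimum. Otherwise the left side is 0.\<close>

lemma fold_inequality:
  fixes u v b :: real
  assumes "u * v \<ge> 0 \<or> (\<bar>u\<bar> \<le> b \<and> \<bar>v\<bar> \<le> b)" "b \<ge> 0"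
  shows "\<bar>u * v\<bar> - u * v \<le> b * (\<bar>u\<bar> + \<bar>v\<bar> - \<bar>u + v\<bar>)"
proof (cases "u * v \<ge> 0")
  case True
  then show ?thesis using assms(2) by simp
next
  case False
  then have uv: "\<bar>u\<bar> \<le> b" "\<bar>v\<bar> \<le> b" using assms(1) by auto
  have "\<bar>u\<bar> * \<bar>v\<bar> \<le> b * min \<bar>u\<bar> \<bar>v\<bar>"
  proof (cases "\<bar>u\<bar> \<le> \<bar>v\<bar>")
    case True
    then show ?thesis using mult_left_mono[OF uv(2), of "\<bar>u\<bar>"] by (simp add: mult.commute min_def)
  next
    case False
    then show ?thesis using mult_right_mono[OF uv(1), of "\<bar>v\<bar>"] by (simp add: min_def)
  qed
  moreover have "\<bar>u\<bar> + \<bar>v\<bar> - \<bar>u + v\<bar> = 2 * min \<bar>u\<bar> \<bar>v\<bar>"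
    using False by (auto simp: not_le mult_less_0_iff)
  moreover have "\<bar>u * v\<bar> - u * v = 2 * (\<bar>u\<bar> * \<bar>v\<bar>)"
    using False by (simp add: abs_mult[symmetric])
  ultimately show ?thesis by simp
qed

lemma finite_has_arg_max:
  fixes f :: "'a \<Rightarrow> real"
  assumes "finite A" "A \<noteq> {}"
  obtains x where "x \<in> A" "\<And>y. y \<in> A \<Longrightarrow> f y \<le> f x"
proof -
  have "Max (f ` A) \<in> f ` A" using assms by simp
  then obtain x where "x \<in> A" "f x = Max (f ` A)" by auto
  then show ?thesis using that[of x] assms by auto
qed

context walsh_group
begin

section \<open>Homomorphisms, signed pushforwards of spectra, and spectra of sign functions\<close>

definition hom :: "('a \<Rightarrow> 'a) \<Rightarrow> bool" where
  "hom M \<longleftrightarrow> (\<forall>x\<in>G. M x \<in> G) \<and> (\<forall>x\<in>G. \<forall>y\<in>G. M (x \<oplus> y) = M x \<oplus> M y)"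

definition kernel :: "('a \<Rightarrow> 'a) \<Rightarrow> 'a set" where
  "kernel M = {x \<in> G. M x = \<zero>}"

definition sign_char :: "('a \<Rightarrow> real) \<Rightarrow> bool" where
  "sign_char \<sigma> \<longleftrightarrow> (\<forall>x\<in>G. \<sigma> x = 1 \<or> \<sigma> x = -1) \<and> (\<forall>x\<in>G. \<forall>y\<in>G. \<sigma> (x \<oplus> y) = \<sigma> x * \<sigma> y)"

text \<open>With \<open>\<sigma> S = chi S a\<close> these are the coefficients of
  \<open>synth p\<close> restricted to the coset through \<open>a\<close> of the annihilator of
  \<open>kernel M\<close>: there \<open>chi S\<close> depends, up to the sign
  \<open>chi S a\<close>, only on \<open>M S\<close>.\<close>

definition push :: "('a \<Rightarrow> 'a) \<Rightarrow> ('a \<Rightarrow> real) \<Rightarrow> ('a \<Rightarrow> real) \<Rightarrow> 'a \<Rightarrow> real" where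
  "push M \<sigma> p T = (\<Sum>S | S \<in> G \<and> M S = T. \<sigma> S * p S)"

text \<open>The convolution square of \<open>p\<close> is the unit mass at zero, that is,
  \<open>synth p\<close> takes only the values 1 and -1. Stated on spectra, the property passes
  directly to pushforwards.\<close>

definition bool_spec :: "('a \<Rightarrow> real) \<Rightarrow> bool" where
  "bool_spec p \<longleftrightarrow> (\<forall>D\<in>G. (\<Sum>S\<in>G. p S * p (S \<oplus> D)) = (if D = \<zero> then 1 else 0))"

lemma hom_in [simp]: "hom M \<Longrightarrow> x \<in> G \<Longrightarrow> M x \<in> G"
  by (simp add: hom_def)

lemma hom_add: "hom M \<Longrightarrow> x \<in> G \<Longrightarrow> y \<in> G \<Longrightarrow> M (x \<oplus> y) = M x \<oplus> M y"
  by (simp add: hom_def)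

lemma hom_zero [simp]: "hom M \<Longrightarrow> M \<zero> = \<zero>"
  using hom_add[of M \<zero> \<zero>] by simp

lemma hom_id: "hom (\<lambda>x. x)" by (simp add: hom_def)

lemma hom_comp: "hom M' \<Longrightarrow> hom M \<Longrightarrow> hom (\<lambda>x. M' (M x))"
  by (simp add: hom_def)

lemma finite_kernel [simp]: "finite (kernel M)" by (simp add: kernel_def)

lemma kernel_subgrp: "hom M \<Longrightarrow> subgrp (kernel M)"
  by (auto simp: subgrp_def kernel_def hom_add)

lemma card_fiber_le:
  assumes "hom M"
  shows "card {x \<in> G. M x = T} \<le> card (kernel M)"
proof (cases "{x \<in> G. M x = T} = {}")
  case True
  then show ?thesis by (metis card.empty le0)
next
  case False
  then obtain a where a: "a \<in> G" "M a = T" by blast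
  have "inj_on ((\<oplus>) a) {x \<in> G. M x = T}"
    by (rule inj_onI) (use a in \<open>metis (no_types, lifting) add_cancel mem_Collect_eq\<close>)
  moreover have "(\<oplus>) a ` {x \<in> G. M x = T} \<subseteq> kernel M"
    using a assms by (auto simp: kernel_def hom_add)
  ultimately show ?thesis by (intro card_inj_on_le) auto
qed

lemma card_kernel_comp:
  assumes "hom M" "hom M'"
  shows "card (kernel (\<lambda>x. M' (M x))) \<le> card (kernel M) * card (kernel M')"
proof -
  have "kernel (\<lambda>x. M' (M x)) \<subseteq> (\<Union>T\<in>kernel M'. {x \<in> G. M x = T})"
    using assms by (auto simp: kernel_def)
  then have "card (kernel (\<lambda>x. M' (M x))) \<le> card (\<Union>T\<in>kernel M'. {x \<in> G. M x = T})"
    by (intro card_mono) auto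
  also have "\<dots> \<le> (\<Sum>T\<in>kernel M'. card {x \<in> G. M x = T})"
    by (rule card_UN_le) simp
  also have "\<dots> \<le> (\<Sum>T\<in>kernel M'. card (kernel M))"
    by (intro sum_mono card_fiber_le assms)
  finally show ?thesis by (simp add: mult.commute)
qed

lemma sign_char_add: "sign_char \<sigma> \<Longrightarrow> x \<in> G \<Longrightarrow> y \<in> G \<Longrightarrow> \<sigma> (x \<oplus> y) = \<sigma> x * \<sigma> y"
  by (simp add: sign_char_def)

lemma sign_char_cases: "sign_char \<sigma> \<Longrightarrow> x \<in> G \<Longrightarrow> \<sigma> x = 1 \<or> \<sigma> x = -1"
  by (simp add: sign_char_def)

lemma sign_char_zero [simp]: "sign_char \<sigma> \<Longrightarrow> \<sigma> \<zero> = 1"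
  using sign_char_add[of \<sigma> \<zero> \<zero>] sign_char_cases[of \<sigma> \<zero>] by auto

lemma sign_char_one: "sign_char (\<lambda>_. 1)" by (simp add: sign_char_def)

lemma sign_char_chi: "z \<in> G \<Longrightarrow> sign_char (\<lambda>S. chi S z)"
  using chi_cases by (auto simp: sign_char_def chi_add_left)

lemma sign_char_comp:
  assumes "hom M" "sign_char \<sigma>" "sign_char \<sigma>'"
  shows "sign_char (\<lambda>S. \<sigma>' (M S) * \<sigma> S)"
  unfolding sign_char_def
proof (intro conjI ballI)
  fix x assume x: "x \<in> G"
  show "\<sigma>' (M x) * \<sigma> x = 1 \<or> \<sigma>' (M x) * \<sigma> x = -1"
    using sign_char_cases[OF assms(2) x] sign_char_cases[OF assms(3), of "M x"] x assms(1) by auto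
next
  fix x y assume "x \<in> G" "y \<in> G"
  then show "\<sigma>' (M (x \<oplus> y)) * \<sigma> (x \<oplus> y) = \<sigma>' (M x) * \<sigma> x * (\<sigma>' (M y) * \<sigma> y)"
    using assms by (simp add: hom_add sign_char_add)
qed

lemma push_push:
  assumes "hom M"
  shows "push M' \<sigma>' (push M \<sigma> p) T = push (\<lambda>x. M' (M x)) (\<lambda>S. \<sigma>' (M S) * \<sigma> S) p T"
proof -
  let ?A = "{S. S \<in> G \<and> M' (M S) = T}" and ?B = "{U. U \<in> G \<and> M' U = T}"
  have "push M' \<sigma>' (push M \<sigma> p) T = (\<Sum>U\<in>?B. \<Sum>S | S \<in> ?A \<and> M S = U. \<sigma>' (M S) * \<sigma> S * p S)"
    unfolding push_def sum_distrib_left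
  proof (rule sum.cong[OF refl])
    fix U assume "U \<in> ?B"
    then show "(\<Sum>S | S \<in> G \<and> M S = U. \<sigma>' U * (\<sigma> S * p S)) =
      (\<Sum>S | S \<in> ?A \<and> M S = U. \<sigma>' (M S) * \<sigma> S * p S)"
      by (intro sum.cong) auto
  qed
  also have "\<dots> = (\<Sum>S\<in>?A. \<sigma>' (M S) * \<sigma> S * p S)"
    by (rule sum.group) (use assms in auto)
  finally show ?thesis by (simp add: push_def)
qed

lemma push_alt: "push M \<sigma> p T = (\<Sum>S\<in>G. if M S = T then \<sigma> S * p S else 0)"
  unfolding push_def by (rule sum.mono_neutral_cong_left) auto

text \<open>In the autocorrelation at \<open>D\<close>, write the second character as
  \<open>S \<oplus> E\<close> with \<open>M E = D\<close>. The signs combine to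
  \<open>\<sigma> E\<close>, so the sum is a signed sum of autocorrelations of \<open>p\<close> at
  such \<open>E\<close>, and only \<open>E = \<zero>\<close> survives.\<close>

lemma bool_spec_push:
  assumes M: "hom M" and s: "sign_char \<sigma>" and p: "bool_spec p"
  shows "bool_spec (push M \<sigma> p)"
  unfolding bool_spec_def
proof
  fix D assume D: "D \<in> G"
  let ?f = "\<lambda>S. \<sigma> S * p S"
  have "(\<Sum>T\<in>G. push M \<sigma> p T * push M \<sigma> p (T \<oplus> D)) =
      (\<Sum>T\<in>G. \<Sum>S\<in>G. if M S = T then ?f S * push M \<sigma> p (M S \<oplus> D) else 0)"
    by (intro sum.cong refl, subst push_alt, simp add: sum_distrib_right, intro sum.cong refl) auto
  also have "\<dots> = (\<Sum>S\<in>G. ?f S * push M \<sigma> p (M S \<oplus> D))"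
    by (subst sum.swap) (use M in simp)
  also have "\<dots> = (\<Sum>S\<in>G. \<Sum>E\<in>G. if M E = D then \<sigma> E * (p S * p (S \<oplus> E)) else 0)"
  proof (rule sum.cong[OF refl])
    fix S assume S: "S \<in> G"
    have "push M \<sigma> p (M S \<oplus> D) = (\<Sum>E\<in>G. if M (S \<oplus> E) = M S \<oplus> D then ?f (S \<oplus> E) else 0)"
      unfolding push_alt
      using sum_translate'[OF S, of "\<lambda>x. if M x = M S \<oplus> D then ?f x else 0"] by simp
    also have "\<dots> = (\<Sum>E\<in>G. if M E = D then \<sigma> S * \<sigma> E * p (S \<oplus> E) else 0)"
    proof (rule sum.cong[OF refl])
      fix E assume E: "E \<in> G"
      have "M (S \<oplus> E) = M S \<oplus> D \<longleftrightarrow> M E = D"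
        using S E D M by (metis add_cancel hom_add hom_in)
      then show "(if M (S \<oplus> E) = M S \<oplus> D then ?f (S \<oplus> E) else 0) =
        (if M E = D then \<sigma> S * \<sigma> E * p (S \<oplus> E) else 0)"
        using S E s by (simp add: sign_char_add)
    qed
    finally have *: "push M \<sigma> p (M S \<oplus> D) = \<dots>" .
    have "\<sigma> S * \<sigma> S = 1" using sign_char_cases[OF s S] by auto
    then have "?f S * (\<sigma> S * \<sigma> E * p (S \<oplus> E)) = \<sigma> E * (p S * p (S \<oplus> E))" for E
      by (simp add: algebra_simps)
    then show "?f S * push M \<sigma> p (M S \<oplus> D) =
        (\<Sum>E\<in>G. if M E = D then \<sigma> E * (p S * p (S \<oplus> E)) else 0)"
      unfolding * sum_distrib_left by (intro sum.cong refl) simp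
  qed
  also have "\<dots> = (\<Sum>E\<in>G. if M E = D then \<sigma> E * (\<Sum>S\<in>G. p S * p (S \<oplus> E)) else 0)"
    by (subst sum.swap) (intro sum.cong refl, simp add: sum_distrib_left)
  also have "\<dots> = (\<Sum>E\<in>G. if E = \<zero> then (if D = \<zero> then 1 else 0) else 0)"
    using p M s unfolding bool_spec_def by (intro sum.cong refl) auto
  also have "\<dots> = (if D = \<zero> then 1 else 0)" by simp
  finally show "(\<Sum>T\<in>G. push M \<sigma> p T * push M \<sigma> p (T \<oplus> D)) = (if D = \<zero> then 1 else 0)" .
qed

text \<open>Shifting the spectrum by \<open>D\<close> multiplies the function by
  \<open>chi D\<close>, so Plancherel turns the autocorrelation into the mean of
  \<open>f * f * chi D = chi D\<close>.\<close>

lemma bool_spec_coeff: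
  assumes "\<And>x. x \<in> G \<Longrightarrow> f x = 1 \<or> f x = -1"
  shows "bool_spec (coeff f)"
  unfolding bool_spec_def
proof
  fix D assume D: "D \<in> G"
  have "(\<Sum>S\<in>G. coeff f S * coeff f (S \<oplus> D)) = (\<Sum>S\<in>G. coeff f S * coeff (\<lambda>x. f x * chi D x) S)"
    using D by (intro sum.cong refl) (simp add: coeff_def chi_add_left mult_ac)
  also have "\<dots> = (\<Sum>x\<in>G. f x * (f x * chi D x)) / N"
    by (simp add: plancherel synth_coeff)
  also have "(\<Sum>x\<in>G. f x * (f x * chi D x)) = (\<Sum>x\<in>G. chi D x)"
    using assms by (intro sum.cong refl) fastforce
  finally show "(\<Sum>S\<in>G. coeff f S * coeff f (S \<oplus> D)) = (if D = \<zero> then 1 else 0)"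
    using D by (simp add: sum_chi)
qed

lemma bool_spec_sum_squares: "bool_spec p \<Longrightarrow> (\<Sum>S\<in>G. (p S)\<^sup>2) = 1"
  unfolding bool_spec_def by (drule bspec[OF _ zero_in]) (simp add: power2_eq_square)

lemma bool_spec_abs_le_1:
  assumes "bool_spec p" "S \<in> G"
  shows "\<bar>p S\<bar> \<le> 1"
proof -
  have "(p S)\<^sup>2 \<le> (\<Sum>S\<in>G. (p S)\<^sup>2)" using assms(2) by (intro member_le_sum) auto
  then show ?thesis using bool_spec_sum_squares[OF assms(1)] by (simp add: abs_square_le_1)
qed

section \<open>Folding along one character\<close>

definition fold_map :: "'a \<Rightarrow> 'a \<Rightarrow> 'a \<Rightarrow> 'a" where
  "fold_map \<gamma> y S = (if chi S y = -1 then S \<oplus> \<gamma> else S)"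

text \<open>Since \<open>chi \<gamma> y = -1\<close>, each pair \<open>S\<close>,
  \<open>S \<oplus> \<gamma>\<close> has exactly one member with \<open>chi _ y = 1\<close>.
  Choosing that member realises the quotient by \<open>\<gamma>\<close> inside
  \<open>G\<close>.\<close>

lemma fold_map:
  assumes "\<gamma> \<in> G" "y \<in> G" "chi \<gamma> y = -1"
  shows hom_fold_map: "hom (fold_map \<gamma> y)"
    and card_kernel_fold_map: "card (kernel (fold_map \<gamma> y)) \<le> 2"
proof -
  show "hom (fold_map \<gamma> y)"
    unfolding hom_def
  proof (intro conjI ballI)
    fix S assume "S \<in> G" then show "fold_map \<gamma> y S \<in> G" using assms by (simp add: fold_map_def)
  next
    fix S T assume ST: "S \<in> G" "T \<in> G"
    then show "fold_map \<gamma> y (S \<oplus> T) = fold_map \<gamma> y S \<oplus> fold_map \<gamma> y T"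
      using assms chi_cases[OF ST(1) assms(2)] chi_cases[OF ST(2) assms(2)]
      by (auto simp: fold_map_def chi_add_left add_ac)
  qed
  have "kernel (fold_map \<gamma> y) \<subseteq> {\<zero>, \<gamma>}"
    using assms by (auto simp: kernel_def fold_map_def split: if_splits)
  then have "card (kernel (fold_map \<gamma> y)) \<le> card {\<zero>, \<gamma>}" by (intro card_mono) auto
  also have "\<dots> \<le> 2" by (simp add: card_insert_le_m1)
  finally show "card (kernel (fold_map \<gamma> y)) \<le> 2" .
qed

text \<open>The factor \<open>(1 + chi T y) / 2\<close> is the indicator of the image of the fold.
  The condition on \<open>\<sigma>\<close> covers the two twists used later, the constant 1 and
  \<open>chi _ y\<close>.\<close>

lemma push_fold_map:
  assumes g: "\<gamma> \<in> G" "y \<in> G" "chi \<gamma> y = -1" and T: "T \<in> G" and s: "sign_char \<sigma>" "\<sigma> T = 1 \<or> chi T y = -1"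
  shows "push (fold_map \<gamma> y) \<sigma> p T = (1 + chi T y) / 2 * (p T + \<sigma> \<gamma> * p (T \<oplus> \<gamma>))"
proof (cases "chi T y = -1")
  case True
  then have empty: "{S. S \<in> G \<and> fold_map \<gamma> y S = T} = {}"
    using g by (auto simp: fold_map_def chi_add_left split: if_splits)
  show ?thesis unfolding push_def empty using True by simp
next
  case False
  then have T1: "chi T y = 1" "\<sigma> T = 1" using chi_cases[OF T g(2)] s(2) by auto
  have g0: "\<gamma> \<noteq> \<zero>" using g by auto
  have "T \<noteq> T \<oplus> \<gamma>" using g0 g T by (metis add_cancel add_self)
  moreover have "{S. S \<in> G \<and> fold_map \<gamma> y S = T} = {T, T \<oplus> \<gamma>}"
    using g T T1 by (auto simp: fold_map_def chi_add_left add_assoc split: if_splits)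
  ultimately show ?thesis using T1 T g s(1) by (simp add: push_def sign_char_add)
qed

text \<open>Folding the two largest coefficients so that they add up. Since \<open>p * p\<close> vanishes at
  \<open>\<alpha> \<oplus> \<beta>\<close>, the constructive interference at \<open>\<alpha>, \<beta>\<close> is balanced by destructive
  interference between coefficients of size at most \<open>\<bar>p \<beta>\<bar>\<close>, which costs \<open>2\<bar>p \<alpha>\<bar>\<close> in the
  \<open>\<ell>\<^sub>1\<close>-norm.\<close>

lemma fold_step:
  assumes p: "bool_spec p" and ab: "\<alpha> \<in> G" "\<beta> \<in> G" "\<alpha> \<noteq> \<beta>"
    and max1: "\<And>S. S \<in> G \<Longrightarrow> \<bar>p S\<bar> \<le> \<bar>p \<alpha>\<bar>"
    and max2: "\<And>S. S \<in> G \<Longrightarrow> S \<noteq> \<alpha> \<Longrightarrow> \<bar>p S\<bar> \<le> \<bar>p \<beta>\<bar>"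
    and nz: "p \<beta> \<noteq> 0"
  obtains M \<sigma> where "hom M" "sign_char \<sigma>" "card (kernel M) \<le> 2"
    "(\<Sum>S\<in>G. \<bar>push M \<sigma> p S\<bar>) \<le> (\<Sum>S\<in>G. \<bar>p S\<bar>) - 2 * \<bar>p \<alpha>\<bar>"
    "\<exists>S\<in>G. \<bar>push M \<sigma> p S\<bar> = \<bar>p \<alpha>\<bar> + \<bar>p \<beta>\<bar>"
proof -
  define \<gamma> where "\<gamma> = \<alpha> \<oplus> \<beta>"
  have g: "\<gamma> \<in> G" "\<gamma> \<noteq> \<zero>" using ab by (auto simp: \<gamma>_def)
  then obtain y where y: "y \<in> G" "chi \<gamma> y = -1" using chi_separates by blast
  have ag: "\<alpha> \<oplus> \<gamma> = \<beta>" "\<beta> \<oplus> \<gamma> = \<alpha>" using ab by (auto simp: \<gamma>_def add_ac)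
  have pa: "p \<alpha> \<noteq> 0" using max1[OF ab(2)] nz by auto
  \<comment> \<open>The twist makes the two coefficients add constructively:
    \<open>\<sigma> \<gamma>\<close> is the sign of \<open>p \<alpha> * p \<beta>\<close>.\<close>
  define \<sigma> where "\<sigma> = (if p \<alpha> * p \<beta> > 0 then (\<lambda>_. 1) else (\<lambda>S. chi S y))"
  define s where "s = \<sigma> \<gamma>"
  have s: "sign_char \<sigma>" using sign_char_one sign_char_chi[OF y(1)] by (simp add: \<sigma>_def)
  have s_eq: "s = (if p \<alpha> * p \<beta> > 0 then 1 else -1)" using y by (simp add: s_def \<sigma>_def)
  have s2: "s * s = 1" "\<bar>s\<bar> = 1" by (auto simp: s_eq)
  define M where "M = fold_map \<gamma> y"
  define h where "h T = p T + s * p (T \<oplus> \<gamma>)" for T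
  define q where "q T = p T * (s * p (T \<oplus> \<gamma>))" for T
  define L where "L = (\<Sum>S\<in>G. \<bar>p S\<bar>)"
  have push: "push M \<sigma> p T = (1 + chi T y) / 2 * h T" if "T \<in> G" for T
    unfolding M_def h_def s_def
    using g y that s chi_cases[OF that y(1)] by (intro push_fold_map) (auto simp: \<sigma>_def)
  have hg: "\<bar>h (T \<oplus> \<gamma>)\<bar> = \<bar>h T\<bar>" if "T \<in> G" for T
    using that g by (auto simp: h_def s_eq)
  \<comment> \<open>Translation by \<open>\<gamma>\<close> keeps \<open>\<bar>h\<bar>\<close> and
    flips the character, so the image of the fold carries exactly half of the total of
    \<open>\<bar>h\<bar>\<close>.\<close>
  have chi0: "(\<Sum>T\<in>G. chi T y * \<bar>h T\<bar>) = 0"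
  proof -
    have "(\<Sum>T\<in>G. chi T y * \<bar>h T\<bar>) = (\<Sum>T\<in>G. chi (T \<oplus> \<gamma>) y * \<bar>h (T \<oplus> \<gamma>)\<bar>)"
      using sum_translate[OF g(1), of "\<lambda>T. chi T y * \<bar>h T\<bar>"] by simp
    also have "\<dots> = - (\<Sum>T\<in>G. chi T y * \<bar>h T\<bar>)"
      using g y by (simp add: hg chi_add_left sum_negf)
    finally show ?thesis by simp
  qed
  have l1: "(\<Sum>T\<in>G. \<bar>push M \<sigma> p T\<bar>) = (\<Sum>T\<in>G. \<bar>h T\<bar>) / 2"
  proof -
    have "\<bar>push M \<sigma> p T\<bar> = (\<bar>h T\<bar> + chi T y * \<bar>h T\<bar>) / 2" if "T \<in> G" for T
      using push[OF that] chi_cases[OF that y(1)] by auto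
    then have "(\<Sum>T\<in>G. \<bar>push M \<sigma> p T\<bar>) = (\<Sum>T\<in>G. (\<bar>h T\<bar> + chi T y * \<bar>h T\<bar>) / 2)"
      by (intro sum.cong) auto
    then show ?thesis using chi0 by (simp add: sum_divide_distrib[symmetric] sum.distrib)
  qed
  \<comment> \<open>This is \<open>bool_spec\<close> at the nonzero point
    \<open>\<gamma>\<close>.\<close>
  have q0: "(\<Sum>T\<in>G. q T) = 0"
  proof -
    have "(\<Sum>T\<in>G. q T) = s * (\<Sum>T\<in>G. p T * p (T \<oplus> \<gamma>))"
      by (simp add: q_def sum_distrib_left mult_ac)
    then show ?thesis using p g by (simp add: bool_spec_def)
  qed
  have qab: "q \<alpha> = \<bar>p \<alpha>\<bar> * \<bar>p \<beta>\<bar>" "q \<beta> = \<bar>p \<alpha>\<bar> * \<bar>p \<beta>\<bar>"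
    using ag by (auto simp: q_def s_eq abs_mult[symmetric] mult_ac)
  have pw: "\<bar>q T\<bar> - q T \<le> \<bar>p \<beta>\<bar> * (\<bar>p T\<bar> + \<bar>p (T \<oplus> \<gamma>)\<bar> - \<bar>h T\<bar>)" if T: "T \<in> G" for T
  proof -
    have "q T \<ge> 0 \<or> (\<bar>p T\<bar> \<le> \<bar>p \<beta>\<bar> \<and> \<bar>s * p (T \<oplus> \<gamma>)\<bar> \<le> \<bar>p \<beta>\<bar>)"
    proof (cases "T = \<alpha> \<or> T = \<beta>")
      case True
      then show ?thesis using qab by auto
    next
      \<comment> \<open>Away from \<open>\<alpha>\<close> and \<open>\<beta>\<close> neither
        \<open>T\<close> nor its partner is \<open>\<alpha>\<close>, so both coefficients are at
        most \<open>\<bar>p \<beta>\<bar>\<close> in absolute value.\<close>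
      case False
      then have "T \<oplus> \<gamma> \<noteq> \<alpha>" using ag T g by (metis add_cancel_right)
      then show ?thesis using False max2 T g s2 by (simp add: abs_mult)
    qed
    then show ?thesis
      using fold_inequality[of "p T" "s * p (T \<oplus> \<gamma>)" "\<bar>p \<beta>\<bar>"] s2
      by (simp add: q_def h_def abs_mult)
  qed
  \<comment> \<open>The constructive terms at \<open>\<alpha>\<close> and \<open>\<beta>\<close>
    bound the positive part of \<open>q\<close> from below; as \<open>q\<close> sums to 0, its
    negative part is as large, and there the triangle inequality is lossy.\<close>
  have "4 * (\<bar>p \<alpha>\<bar> * \<bar>p \<beta>\<bar>) = (\<Sum>T\<in>{\<alpha>, \<beta>}. \<bar>q T\<bar> + q T)"
    using qab ab by simp
  also have "\<dots> \<le> (\<Sum>T\<in>G. \<bar>q T\<bar> + q T)"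
    using ab by (intro sum_mono2) auto
  also have "\<dots> = (\<Sum>T\<in>G. \<bar>q T\<bar> - q T)"
    using q0 by (simp add: sum.distrib sum_subtractf)
  also have "\<dots> \<le> (\<Sum>T\<in>G. \<bar>p \<beta>\<bar> * (\<bar>p T\<bar> + \<bar>p (T \<oplus> \<gamma>)\<bar> - \<bar>h T\<bar>))"
    by (rule sum_mono) (rule pw)
  also have "\<dots> = \<bar>p \<beta>\<bar> * (2 * L - (\<Sum>T\<in>G. \<bar>h T\<bar>))"
    using sum_translate[OF g(1), of "\<lambda>T. \<bar>p T\<bar>"]
    by (simp add: L_def sum_distrib_left[symmetric] sum.distrib sum_subtractf)
  finally have "\<bar>p \<beta>\<bar> * (4 * \<bar>p \<alpha>\<bar>) \<le> \<bar>p \<beta>\<bar> * (2 * L - (\<Sum>T\<in>G. \<bar>h T\<bar>))"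
    by (simp add: mult_ac)
  then have "4 * \<bar>p \<alpha>\<bar> \<le> 2 * L - (\<Sum>T\<in>G. \<bar>h T\<bar>)" using nz by simp
  then have drop: "(\<Sum>S\<in>G. \<bar>push M \<sigma> p S\<bar>) \<le> (\<Sum>S\<in>G. \<bar>p S\<bar>) - 2 * \<bar>p \<alpha>\<bar>"
    by (simp add: l1 L_def)
  have ha: "\<bar>h \<alpha>\<bar> = \<bar>p \<alpha>\<bar> + \<bar>p \<beta>\<bar>"
    unfolding h_def ag using nz pa by (auto simp: s_eq mult_less_0_iff zero_less_mult_iff)
  \<comment> \<open>The merged coefficient sits at whichever of \<open>\<alpha>\<close>,
    \<open>\<beta>\<close> is the representative of the pair.\<close>
  have "\<exists>S\<in>G. \<bar>push M \<sigma> p S\<bar> = \<bar>p \<alpha>\<bar> + \<bar>p \<beta>\<bar>"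
  proof (cases "chi \<alpha> y = 1")
    case True
    then show ?thesis using push[OF ab(1)] ha ab(1) by (intro bexI[of _ \<alpha>]) simp_all
  next
    case False
    then have "chi \<alpha> y = -1" using chi_cases[OF ab(1) y(1)] by auto
    then have "chi \<beta> y = 1" using ag(1) y ab g by (metis chi_add_left mult_minus1 minus_minus)
    moreover have "\<bar>h \<beta>\<bar> = \<bar>h \<alpha>\<bar>" using hg[OF ab(1)] ag by simp
    ultimately show ?thesis using push[OF ab(2)] ha ab(2) by (intro bexI[of _ \<beta>]) simp_all
  qed
  then show ?thesis
    using that[of M \<sigma>] hom_fold_map[OF g(1) y] card_kernel_fold_map[OF g(1) y] s drop
    by (simp add: M_def)
qed

text \<open>Induction on a bound for the potential, the \<open>l1\<close>-norm plus
  \<open>4 / 3 * L * (1 - \<bar>p \<alpha>\<bar>)\<close>: one fold of the two largest coefficients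
  lowers it by at least 1. The process stops when one character is left, which is then sent to
  zero.\<close>

lemma kill:
  assumes "bool_spec p" "(\<Sum>S\<in>G. \<bar>p S\<bar>) \<le> L" "\<alpha> \<in> G"
    "(\<Sum>S\<in>G. \<bar>p S\<bar>) + 4 / 3 * L * (1 - \<bar>p \<alpha>\<bar>) \<le> real j"
  shows "\<exists>M \<sigma> t. hom M \<and> sign_char \<sigma> \<and> card (kernel M) \<le> 2 ^ t \<and> t \<le> Suc j \<and>
    (\<forall>T\<in>G. T \<noteq> \<zero> \<longrightarrow> push M \<sigma> p T = 0)"
  using assms
proof (induction j arbitrary: p \<alpha>)
  \<comment> \<open>Potential 0 would force \<open>p = 0\<close>, against the sum of squares being
    1.\<close>
  case (0 p \<alpha>)
  have L: "0 \<le> L" by (rule order.trans[OF sum_nonneg 0(2)]) simp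
  have "(\<Sum>S\<in>G. \<bar>p S\<bar>) \<le> 0"
    using 0(4) mult_nonneg_nonneg[OF L, of "1 - \<bar>p \<alpha>\<bar>"] bool_spec_abs_le_1[OF 0(1) 0(3)] by simp
  moreover have "(\<Sum>S\<in>G. \<bar>p S\<bar>) \<ge> 0" by (rule sum_nonneg) simp
  ultimately have "\<forall>S\<in>G. p S = 0"
    using sum_nonneg_eq_0_iff[of G "\<lambda>S. \<bar>p S\<bar>"] by simp
  then have "(\<Sum>S\<in>G. (p S)\<^sup>2) = 0" by simp
  then show ?case using bool_spec_sum_squares[OF 0(1)] by simp
next
  case (Suc j p \<alpha>0)
  define l where "l = (\<Sum>S\<in>G. \<bar>p S\<bar>)"
  have L0: "0 \<le> L" by (rule order.trans[OF sum_nonneg Suc(3)]) simp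
  \<comment> \<open>Passing to a largest coefficient does not increase the potential.\<close>
  obtain \<alpha> where a: "\<alpha> \<in> G" "\<And>S. S \<in> G \<Longrightarrow> \<bar>p S\<bar> \<le> \<bar>p \<alpha>\<bar>"
    using finite_has_arg_max[OF finite_G G_nonempty, of "\<lambda>S. \<bar>p S\<bar>"] by blast
  have "L * (1 - \<bar>p \<alpha>\<bar>) \<le> L * (1 - \<bar>p \<alpha>0\<bar>)"
    using a(2)[OF Suc(4)] L0 by (intro mult_left_mono) auto
  then have pot: "l + 4 / 3 * L * (1 - \<bar>p \<alpha>\<bar>) \<le> real (Suc j)"
    using Suc(5) by (simp add: l_def)
  show ?case
  proof (cases "\<forall>S\<in>G. S \<noteq> \<alpha> \<longrightarrow> p S = 0")
    case True
    obtain M where M: "hom M" "card (kernel M) \<le> 2" "M \<alpha> = \<zero>"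
    proof (cases "\<alpha> = \<zero>")
      case True
      moreover have "kernel (\<lambda>x. x) = {\<zero>}" by (auto simp: kernel_def)
      then have "card (kernel (\<lambda>x. x)) \<le> 2" by simp
      ultimately show ?thesis using that hom_id by simp
    next
      case False
      then obtain y where y: "y \<in> G" "chi \<alpha> y = -1" using chi_separates a by blast
      show ?thesis
        using that[OF hom_fold_map[OF a(1) y] card_kernel_fold_map[OF a(1) y]] y a
        by (simp add: fold_map_def)
    qed
    have "push M (\<lambda>_. 1) p T = 0" if "T \<in> G" "T \<noteq> \<zero>" for T
      unfolding push_def using True M that by (intro sum.neutral) auto
    then show ?thesis
      using M(1,2) sign_char_one by (intro exI[of _ M] exI[of _ "\<lambda>_. 1"] exI[of _ 1]) auto
  next
    case False
    then have ne: "G - {\<alpha>} \<noteq> {}" by auto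
    obtain \<beta> where b: "\<beta> \<in> G - {\<alpha>}" "\<And>S. S \<in> G - {\<alpha>} \<Longrightarrow> \<bar>p S\<bar> \<le> \<bar>p \<beta>\<bar>"
      using finite_has_arg_max[OF _ ne, of "\<lambda>S. \<bar>p S\<bar>"] by blast
    have pb: "p \<beta> \<noteq> 0" using False b(2) by fastforce
    obtain M \<sigma> where M: "hom M" "sign_char \<sigma>" "card (kernel M) \<le> 2"
      and drop: "(\<Sum>S\<in>G. \<bar>push M \<sigma> p S\<bar>) \<le> l - 2 * \<bar>p \<alpha>\<bar>"
      and inc: "\<exists>S\<in>G. \<bar>push M \<sigma> p S\<bar> = \<bar>p \<alpha>\<bar> + \<bar>p \<beta>\<bar>"
      unfolding l_def
      by (rule fold_step[OF Suc.prems(1) a(1), of \<beta>]) (use a b pb in auto)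
    obtain \<alpha>' where a': "\<alpha>' \<in> G" "\<bar>push M \<sigma> p \<alpha>'\<bar> = \<bar>p \<alpha>\<bar> + \<bar>p \<beta>\<bar>" using inc by blast
    \<comment> \<open>Parseval forces a lower bound on the second largest coefficient: all terms
      except that of \<open>\<alpha>\<close> contribute at most
      \<open>\<bar>p \<beta>\<bar> * L\<close> in total.\<close>
    have "1 = (\<Sum>S\<in>G. (p S)\<^sup>2)" using bool_spec_sum_squares[OF Suc.prems(1)] by simp
    also have "\<dots> = (p \<alpha>)\<^sup>2 + (\<Sum>S\<in>G - {\<alpha>}. \<bar>p S\<bar> * \<bar>p S\<bar>)"
      using a by (simp add: sum.remove power2_eq_square)
    also have "(\<Sum>S\<in>G - {\<alpha>}. \<bar>p S\<bar> * \<bar>p S\<bar>) \<le> (\<Sum>S\<in>G - {\<alpha>}. \<bar>p \<beta>\<bar> * \<bar>p S\<bar>)"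
      by (intro sum_mono mult_right_mono b(2)) auto
    also have "\<dots> \<le> \<bar>p \<beta>\<bar> * l"
      unfolding l_def sum_distrib_left[symmetric] by (intro mult_left_mono sum_mono2) auto
    also have "\<dots> \<le> \<bar>p \<beta>\<bar> * L" using Suc.prems(2) by (intro mult_left_mono) (auto simp: l_def)
    finally have sq: "1 \<le> (p \<alpha>)\<^sup>2 + \<bar>p \<beta>\<bar> * L" by simp
    have step: "(\<Sum>S\<in>G. \<bar>push M \<sigma> p S\<bar>) + 4 / 3 * L * (1 - \<bar>push M \<sigma> p \<alpha>'\<bar>) \<le> real j"
    \<comment> \<open>If the largest coefficient is at least 1/2, the norm alone drops by 1.
      Otherwise \<open>L * \<bar>p \<beta>\<bar>\<close> is at least 3/4, and the growth of the
      largest coefficient pays 1 through the factor 4/3.\<close>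
    proof (cases "\<bar>p \<alpha>\<bar> \<ge> 1 / 2")
      case True
      have "L * (1 - \<bar>push M \<sigma> p \<alpha>'\<bar>) \<le> L * (1 - \<bar>p \<alpha>\<bar>)"
        using L0 a' by (intro mult_left_mono) auto
      then show ?thesis using True drop pot by simp
    next
      case False
      then have "(p \<alpha>)\<^sup>2 \<le> 1 / 4"
        using power_mono[of "\<bar>p \<alpha>\<bar>" "1/2" 2] by (simp add: power2_eq_square)
      then have "3 / 4 \<le> L * \<bar>p \<beta>\<bar>" using sq by (simp add: mult.commute)
      moreover have "4 / 3 * L * (1 - \<bar>push M \<sigma> p \<alpha>'\<bar>) =
          4 / 3 * L * (1 - \<bar>p \<alpha>\<bar>) - 4 / 3 * (L * \<bar>p \<beta>\<bar>)"
        by (simp add: a'(2) field_simps)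
      ultimately show ?thesis using drop pot abs_ge_zero[of "p \<alpha>"] by linarith
    qed
    have l': "(\<Sum>S\<in>G. \<bar>push M \<sigma> p S\<bar>) \<le> L" using drop Suc.prems(2) by (simp add: l_def)
    obtain M' \<sigma>' t where M': "hom M'" "sign_char \<sigma>'" "card (kernel M') \<le> 2 ^ t" "t \<le> Suc j"
      "\<forall>T\<in>G. T \<noteq> \<zero> \<longrightarrow> push M' \<sigma>' (push M \<sigma> p) T = 0"
      using Suc.IH[OF bool_spec_push[OF M(1,2) Suc.prems(1)] l' a'(1) step] by blast
    have "card (kernel (\<lambda>x. M' (M x))) \<le> 2 * 2 ^ t"
      using card_kernel_comp[OF M(1) M'(1)] mult_le_mono[OF M(3) M'(3)] by linarith
    then show ?thesis
      using M' M by (intro exI[of _ "\<lambda>x. M' (M x)"] exI[of _ "\<lambda>S. \<sigma>' (M S) * \<sigma> S"] exI[of _ "Suc t"])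
        (auto simp: hom_comp sign_char_comp push_push)
  qed
qed

end

section \<open>The Fourier dimension of sparse functions\<close>

context walsh_group
begin

text \<open>Cauchy-Schwarz bounds the \<open>l1\<close>-norm by \<open>L = sqrt (m + 1)\<close>, so
  the initial potential is at most \<open>7 / 3 * L\<close>. As \<open>L\<close> is at most
  \<open>3 / 2 * sqrt m\<close>, rounding up and the \<open>Suc\<close> in \<open>kill\<close> give
  at most \<open>7 / 2 * sqrt m + 2\<close>, hence at most \<open>6 * sqrt m\<close>.\<close>

lemma kill_sparse:
  assumes p: "bool_spec p" and A: "supp p - {\<zero>} \<noteq> {}"
  obtains M \<sigma> t where "hom M" "sign_char \<sigma>" "card (kernel M) \<le> 2 ^ t"
    "real t \<le> 6 * sqrt (real (card (supp p - {\<zero>})))"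
    "\<And>T. T \<in> G \<Longrightarrow> T \<noteq> \<zero> \<Longrightarrow> push M \<sigma> p T = 0"
proof -
  define m where "m = card (supp p - {\<zero>})"
  have m: "m \<ge> 1" using A by (simp add: m_def Suc_leI card_gt_0_iff)
  define L where "L = sqrt (real (m + 1))"
  have "card (supp p) \<le> card (insert \<zero> (supp p - {\<zero>}))" by (intro card_mono) auto
  also have "\<dots> = m + 1" unfolding m_def by (subst card_insert_disjoint) auto
  finally have "(\<Sum>S\<in>G. \<bar>p S\<bar>)\<^sup>2 \<le> real (m + 1)"
    using l1_squared_le[of p "m + 1"] bool_spec_sum_squares[OF p] by simp
  then have l1: "(\<Sum>S\<in>G. \<bar>p S\<bar>) \<le> L" unfolding L_def by (intro real_le_rsqrt)
  define j where "j = nat \<lceil>7 / 3 * L\<rceil>"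
  have L0: "L \<ge> 0" by (simp add: L_def)
  have j: "7 / 3 * L \<le> real j" "real j \<le> 7 / 3 * L + 1"
    using L0 unfolding j_def by linarith+
  have "4 / 3 * L * (1 - \<bar>p \<zero>\<bar>) \<le> 4 / 3 * L * 1" using L0 by (intro mult_left_mono) auto
  then have "(\<Sum>S\<in>G. \<bar>p S\<bar>) + 4 / 3 * L * (1 - \<bar>p \<zero>\<bar>) \<le> real j" using l1 j by simp
  from kill[OF p l1 zero_in this] obtain M \<sigma> t where M: "hom M" "sign_char \<sigma>" "card (kernel M) \<le> 2 ^ t"
    "t \<le> Suc j" "\<forall>T\<in>G. T \<noteq> \<zero> \<longrightarrow> push M \<sigma> p T = 0" by blast
  have "L \<le> sqrt ((3 / 2)\<^sup>2 * real m)"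
    unfolding L_def using m by (intro real_sqrt_le_mono) (simp add: power2_eq_square)
  then have "L \<le> 3 / 2 * sqrt (real m)" by (simp add: real_sqrt_mult)
  moreover have "sqrt (real m) \<ge> 1" using m by simp
  ultimately have "real t \<le> 6 * sqrt (real m)" using M(4) j by linarith
  then show ?thesis using that M unfolding m_def by blast
qed

text \<open>Averaging over the restrictions \<open>a\<close> to cosets of the annihilator of \<open>kernel M\<close>, some
  restricted function has at least \<open>m\<^sup>2 / k\<close> nonconstant characters. Making it constant
  merges these characters pairwise or with the constant one.\<close>

lemma fourier_dim_step:
  assumes p: "bool_spec p" and k: "card (supp p) \<le> k" and M: "hom M"
    and m: "m = card (M ` supp p - {\<zero>})" "m > 0"
  obtains M' u where "hom M'" "card (kernel M') \<le> 2 ^ u"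
    "card ((\<lambda>x. M' (M x)) ` supp p - {\<zero>}) < m"
    "real u \<le> 12 * sqrt (real k) * ((real m - real (card ((\<lambda>x. M' (M x)) ` supp p - {\<zero>}))) / real m)"
proof -
  define B where "B = M ` supp p - {\<zero>}"
  define q where "q a = push M (\<lambda>S. chi S a) p" for a
  define A where "A a = supp (q a) - {\<zero>}" for a
  define n where "n C = card {S \<in> supp p. M S = C}" for C
  have finB: "finite B" and cardB: "card B = m" and BG: "B \<subseteq> G"
    using m M supp_subset[of p] by (auto simp: B_def)
  have q_synth: "q a C = synth (\<lambda>S. if M S = C then p S else 0) a" if "a \<in> G" for a C
    unfolding q_def push_alt synth_def by (intro sum.cong) auto
  have AB: "A a \<subseteq> B" for a
  proof
    fix C assume C: "C \<in> A a"
    then have "(\<Sum>S | S \<in> G \<and> M S = C. chi S a * p S) \<noteq> 0"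
      by (auto simp: A_def supp_def q_def push_def)
    then obtain S where "S \<in> {S. S \<in> G \<and> M S = C}" "chi S a * p S \<noteq> 0"
      by (rule sum.not_neutral_contains_not_neutral)
    then show "C \<in> B" using C by (auto simp: B_def supp_def A_def)
  qed
  have k0: "k > 0"
  proof (rule ccontr)
    assume "\<not> k > 0"
    then have "supp p = {}" using k by simp
    then show False using m by simp
  qed
  \<comment> \<open>By the uncertainty principle a class of \<open>n C\<close> characters survives
    in at least \<open>N / n C\<close> restrictions. The tangent bound \<open>1 / n\<close> at least
    \<open>2 * lam - lam^2 * n\<close> is linear in \<open>n\<close>, so only the sum of the class
    sizes, at most \<open>k\<close>, matters; this \<open>lam\<close> optimises the result.\<close>
  define lam where "lam = real m / real k"
  have cnt: "real (card {a \<in> G. q a C \<noteq> 0}) \<ge> N * (2 * lam - lam\<^sup>2 * real (n C))" if C: "C \<in> B" for C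
  proof -
    have supp: "supp (\<lambda>S. if M S = C then p S else 0) = {S \<in> supp p. M S = C}"
      by (auto simp: supp_def)
    obtain S where S: "S \<in> supp p" "M S = C" using C by (auto simp: B_def)
    have n0: "n C > 0" unfolding n_def using S by (intro card_gt_0_iff[THEN iffD2]) auto
    have "N \<le> real (n C) * real (card {a \<in> G. synth (\<lambda>S. if M S = C then p S else 0) a \<noteq> 0})"
      by (rule uncertainty_synth) (use S in \<open>auto simp: n_def supp, auto simp: supp_def\<close>)
    also have "{a \<in> G. synth (\<lambda>S. if M S = C then p S else 0) a \<noteq> 0} = {a \<in> G. q a C \<noteq> 0}"
      by (auto simp: q_synth)
    finally have 1: "N \<le> real (n C) * real (card {a \<in> G. q a C \<noteq> 0})" .
    have "real (n C) * (2 * lam - lam\<^sup>2 * real (n C)) \<le> 1"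
      using zero_le_power2[of "1 - lam * real (n C)"] by (simp add: power2_eq_square algebra_simps)
    then have "N * (real (n C) * (2 * lam - lam\<^sup>2 * real (n C))) \<le> N * 1"
      by (intro mult_left_mono) auto
    also have "\<dots> \<le> real (n C) * real (card {a \<in> G. q a C \<noteq> 0})" using 1 by simp
    finally have "real (n C) * (N * (2 * lam - lam\<^sup>2 * real (n C))) \<le> real (n C) * real (card {a \<in> G. q a C \<noteq> 0})"
      by (simp only: mult.left_commute)
    then show ?thesis using n0 by simp
  qed
  have sum_n: "real (\<Sum>C\<in>B. n C) \<le> real k"
  proof -
    have "(\<Sum>C\<in>B. n C) = card (\<Union>C\<in>B. {S \<in> supp p. M S = C})"
      unfolding n_def using finB by (intro card_UN_disjoint[symmetric]) auto
    also have "\<dots> \<le> card (supp p)" by (intro card_mono) auto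
    finally show ?thesis using k by (simp only: of_nat_le_iff)
  qed
  have "N * (real m)\<^sup>2 / real k = N * (2 * lam * real m - lam\<^sup>2 * real k)"
    using k0 by (simp add: lam_def power2_eq_square field_simps)
  also have "\<dots> \<le> N * (2 * lam * real m - lam\<^sup>2 * real (\<Sum>C\<in>B. n C))"
    using sum_n by (intro mult_left_mono diff_left_mono) auto
  also have "\<dots> = (\<Sum>C\<in>B. N * (2 * lam - lam\<^sup>2 * real (n C)))"
    by (simp add: sum_distrib_left[symmetric] sum_subtractf cardB)
  also have "\<dots> \<le> (\<Sum>C\<in>B. real (card {a \<in> G. q a C \<noteq> 0}))"
    by (rule sum_mono) (rule cnt)
  also have "\<dots> = (\<Sum>C\<in>B. \<Sum>a\<in>G. if q a C \<noteq> 0 then 1 else 0)"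
    by (simp add: sum.If_cases Int_def)
  also have "\<dots> = (\<Sum>a\<in>G. \<Sum>C\<in>B. if q a C \<noteq> 0 then 1 else 0)"
    by (rule sum.swap)
  also have "\<dots> = (\<Sum>a\<in>G. real (card (A a)))"
  proof (rule sum.cong[OF refl])
    fix a
    have "A a = {C \<in> B. q a C \<noteq> 0}" using AB[of a] BG by (auto simp: A_def supp_def B_def)
    then show "(\<Sum>C\<in>B. if q a C \<noteq> 0 then 1 else 0) = real (card (A a))"
      using finB by (simp add: sum.If_cases Int_def)
  qed
  finally have avg: "N * (real m)\<^sup>2 / real k \<le> (\<Sum>a\<in>G. real (card (A a)))" .
  have "\<exists>a\<in>G. (real m)\<^sup>2 / real k \<le> real (card (A a))"
  proof (rule ccontr)
    assume "\<not> ?thesis"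
    then have "(\<Sum>a\<in>G. real (card (A a))) < (\<Sum>a\<in>G. (real m)\<^sup>2 / real k)"
      by (intro sum_strict_mono) auto
    then show False using avg by simp
  qed
  then obtain a where a: "a \<in> G" "(real m)\<^sup>2 / real k \<le> real (card (A a))" by blast
  define ma where "ma = card (A a)"
  have "0 < (real m)\<^sup>2 / real k" using m(2) k0 by simp
  then have "real ma > 0" using a(2) unfolding ma_def by (rule less_le_trans)
  then have ma0: "ma > 0" by simp
  have qb: "bool_spec (q a)"
    unfolding q_def using M sign_char_chi[OF a(1)] p by (rule bool_spec_push)
  have "supp (q a) - {\<zero>} \<noteq> {}" using ma0 by (auto simp: ma_def A_def card_gt_0_iff)
  then obtain M' \<sigma>' u where M': "hom M'" "sign_char \<sigma>'" "card (kernel M') \<le> 2 ^ u"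
    "real u \<le> 6 * sqrt (real ma)" "\<And>T. T \<in> G \<Longrightarrow> T \<noteq> \<zero> \<Longrightarrow> push M' \<sigma>' (q a) T = 0"
    using kill_sparse[OF qb] unfolding ma_def A_def by metis
  define m2 where "m2 = card ((\<lambda>x. M' (M x)) ` supp p - {\<zero>})"
  define A' where "A' = {C \<in> A a. M' C \<noteq> \<zero>}"
  have finA: "finite (A a)" "A a \<subseteq> G" by (auto simp: A_def supp_def)
  have finA': "finite A'" "A' \<subseteq> A a" using finA by (auto simp: A'_def)
  \<comment> \<open>The coefficients over a nonconstant class cancel after the fold, which a single
    nonzero coefficient cannot do.\<close>
  have fib: "2 \<le> card {C \<in> A'. M' C = T}" if T: "T \<in> M' ` A'" for T
  proof (rule ccontr)
    assume not: "\<not> ?thesis"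
    obtain C0 where C0: "C0 \<in> A'" "T = M' C0" using T by blast
    have C0G: "C0 \<in> G" and T0: "T \<noteq> \<zero>" using C0 finA finA' by (auto simp: A'_def)
    have "card {C \<in> A'. M' C = T} > 0" using C0 finA' by (intro card_gt_0_iff[THEN iffD2]) auto
    then have "card {C \<in> A'. M' C = T} = 1" using not by linarith
    then obtain D where D: "{C \<in> A'. M' C = T} = {D}" by (rule card_1_singletonE)
    have "C0 \<in> {C \<in> A'. M' C = T}" using C0 by simp
    then have "D = C0" unfolding D by simp
    then have uniq: "{C \<in> A'. M' C = T} = {C0}" using D by simp
    have "0 = push M' \<sigma>' (q a) T" using M'(5) T0 C0 C0G M'(1) by simp
    also have "\<dots> = (\<Sum>C\<in>{C0}. \<sigma>' C * q a C)"
      unfolding push_def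
    proof (rule sum.mono_neutral_right)
      show "\<forall>C\<in>{S. S \<in> G \<and> M' S = T} - {C0}. \<sigma>' C * q a C = 0"
      proof
        fix C assume C: "C \<in> {S. S \<in> G \<and> M' S = T} - {C0}"
        then have "C \<noteq> \<zero>" using T0 M'(1) by auto
        then have "q a C = 0" using C uniq T0 by (auto simp: A'_def A_def supp_def)
        then show "\<sigma>' C * q a C = 0" by simp
      qed
    qed (use C0 C0G in auto)
    also have "\<dots> \<noteq> 0"
      using C0 sign_char_cases[OF M'(2) C0G] by (auto simp: A'_def A_def supp_def)
    finally show False by simp
  qed
  have "2 * card (M' ` A') \<le> (\<Sum>T\<in>M' ` A'. card {C \<in> A'. M' C = T})"
    using sum_mono[OF fib, of "M' ` A'" "\<lambda>x. x"] by simp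
  also have "\<dots> = (\<Sum>T\<in>M' ` A'. \<Sum>C | C \<in> A' \<and> M' C = T. 1)" by simp
  also have "\<dots> = card A'" using sum.group[OF finA'(1), of "M' ` A'" M' "\<lambda>_. 1 :: nat"] finA' by simp
  also have "\<dots> \<le> ma" unfolding ma_def using finA finA' by (intro card_mono) auto
  finally have half: "2 * card (M' ` A') \<le> ma" .
  \<comment> \<open>The classes outside \<open>A a\<close> are only mapped, those inside are merged
    to at most half as many; hence at least \<open>ma / 2\<close> classes disappear.\<close>
  have "(\<lambda>x. M' (M x)) ` supp p - {\<zero>} \<subseteq> M' ` (B - A a) \<union> M' ` A'"
  proof
    fix y assume "y \<in> (\<lambda>x. M' (M x)) ` supp p - {\<zero>}"
    then obtain S where S: "S \<in> supp p" "y = M' (M S)" "y \<noteq> \<zero>" by blast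
    then have "M S \<noteq> \<zero>" using hom_zero[OF M'(1)] by metis
    then have "M S \<in> B" using S(1) by (simp add: B_def)
    then have "M S \<in> B - A a \<or> M S \<in> A'" using S by (auto simp: A'_def)
    then show "y \<in> M' ` (B - A a) \<union> M' ` A'" using S(2) by blast
  qed
  then have "m2 \<le> card (M' ` (B - A a) \<union> M' ` A')"
    unfolding m2_def using finB finA' by (intro card_mono) auto
  also have "\<dots> \<le> card (M' ` (B - A a)) + card (M' ` A')" by (rule card_Un_le)
  also have "\<dots> \<le> card (B - A a) + card (M' ` A')"
    using finB by (intro add_right_mono card_image_le) auto
  also have "card (B - A a) = m - ma"
    using AB[of a] finA cardB by (simp add: card_Diff_subset ma_def)
  finally have m2_le: "m2 \<le> m - ma + card (M' ` A')" .
  have ma_m: "ma \<le> m" using AB[of a] finB cardB card_mono by (metis ma_def)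
  have nat2: "2 * m2 + ma \<le> 2 * m" using m2_le half ma_m by linarith
  have "real (2 * m2 + ma) \<le> real (2 * m)" using nat2 by (simp only: of_nat_le_iff)
  then have m2: "real ma \<le> 2 * (real m - real m2)" by simp
  have lt: "m2 < m" using nat2 ma0 by linarith
  \<comment> \<open>From \<open>ma\<close> at least \<open>m^2 / k\<close>, the cost
    \<open>6 * sqrt ma\<close> is charged to the relative decrease of the number of classes.\<close>
  have "real m / sqrt (real k) \<le> sqrt (real ma)"
    by (rule real_le_rsqrt) (use a(2) in \<open>simp add: power_divide ma_def\<close>)
  then have r: "real m \<le> sqrt (real k) * sqrt (real ma)" using k0 by (simp add: field_simps)
  have "real u * real m \<le> 6 * sqrt (real ma) * (sqrt (real k) * sqrt (real ma))"
    using M'(4) r by (intro mult_mono) auto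
  also have "\<dots> = 6 * sqrt (real k) * real ma" by simp
  also have "\<dots> \<le> 6 * sqrt (real k) * (2 * (real m - real m2))"
    using m2 by (intro mult_left_mono) auto
  finally have "real u \<le> 12 * sqrt (real k) * ((real m - real m2) / real m)"
    using m(2) by (simp add: field_simps)
  then show ?thesis using that M'(1,3) lt unfolding m2_def by blast
qed

text \<open>An upper bound for the harmonic number of \<open>m\<close>; relative decreases
  \<open>(b - a) / b\<close> telescope against it down to 0 classes.\<close>

definition harm_bound :: "nat \<Rightarrow> real" where
  "harm_bound m = (if m = 0 then 0 else 1 + ln (real m))"

lemma harm_bound_diff:
  assumes "a < b"
  shows "(real b - real a) / real b \<le> harm_bound b - harm_bound a"
proof (cases "a = 0")
  case True
  then show ?thesis using assms by (simp add: harm_bound_def)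
next
  case False
  have "ln (real a / real b) \<le> real a / real b - 1"
    using False assms by (intro ln_le_minus_one) auto
  then show ?thesis using False assms by (simp add: harm_bound_def ln_div diff_divide_distrib)
qed

text \<open>Strong induction on the number of nonconstant classes. Kernel sizes multiply under
  composition, and once no nonconstant class is left the support lies in the kernel.\<close>

lemma fourier_dim_iterate:
  assumes p: "bool_spec p" and k: "card (supp p) \<le> k" and M: "hom M"
  shows "\<exists>M' u. hom M' \<and> card (kernel M') \<le> card (kernel M) * 2 ^ u \<and> supp p \<subseteq> kernel M' \<and>
    real u \<le> 12 * sqrt (real k) * harm_bound (card (M ` supp p - {\<zero>}))"
  using M
proof (induction "card (M ` supp p - {\<zero>})" arbitrary: M rule: less_induct)
  case (less M)
  define m where "m = card (M ` supp p - {\<zero>})"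
  show ?case
  proof (cases "m = 0")
    case True
    then have "M ` supp p - {\<zero>} = {}" unfolding m_def by (subst (asm) card_0_eq) auto
    then have "supp p \<subseteq> kernel M" using supp_subset[of p] by (auto simp: kernel_def)
    then show ?thesis using less.prems True by (intro exI[of _ M] exI[of _ 0]) (auto simp: harm_bound_def m_def)
  next
    case False
    then obtain M1 u where M1: "hom M1" "card (kernel M1) \<le> 2 ^ u"
      "card ((\<lambda>x. M1 (M x)) ` supp p - {\<zero>}) < m"
      "real u \<le> 12 * sqrt (real k) * ((real m - real (card ((\<lambda>x. M1 (M x)) ` supp p - {\<zero>}))) / real m)"
      using fourier_dim_step[OF p k less.prems m_def] by blast
    define m2 where "m2 = card ((\<lambda>x. M1 (M x)) ` supp p - {\<zero>})"
    from less.hyps[of "\<lambda>x. M1 (M x)"] M1 less.prems obtain M' v where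
      M': "hom M'" "card (kernel M') \<le> card (kernel (\<lambda>x. M1 (M x))) * 2 ^ v" "supp p \<subseteq> kernel M'"
      "real v \<le> 12 * sqrt (real k) * harm_bound m2"
      by (auto simp: m_def m2_def hom_comp)
    have "card (kernel (\<lambda>x. M1 (M x))) \<le> card (kernel M) * 2 ^ u"
      using card_kernel_comp[OF less.prems M1(1)] mult_le_mono2[OF M1(2)] le_trans by blast
    then have "card (kernel M') \<le> card (kernel M) * 2 ^ u * 2 ^ v"
      using M'(2) mult_le_mono1 le_trans by blast
    moreover have "real u \<le> 12 * sqrt (real k) * (harm_bound m - harm_bound m2)"
      by (rule order.trans[OF M1(4)[folded m2_def]], rule mult_left_mono)
        (use harm_bound_diff[of m2 m] M1(3) in \<open>auto simp: m2_def\<close>)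
    ultimately show ?thesis
      using M' by (intro exI[of _ M'] exI[of _ "u + v"]) (auto simp: power_add algebra_simps m_def[symmetric])
  qed
qed

text \<open>Sanyal's bound on the Fourier dimension: start the iteration at the identity, whose
  kernel is trivial, and take the final kernel as \<open>W\<close>.\<close>

lemma fourier_dim:
  assumes "\<And>x. x \<in> G \<Longrightarrow> f x = 1 \<or> f x = -1" and k: "card (supp (coeff f)) \<le> k" "k \<ge> 1"
  obtains W u where "subgrp W" "card W \<le> 2 ^ u" "supp (coeff f) \<subseteq> W"
    "real u \<le> 12 * sqrt (real k) * (1 + ln (real k))"
proof -
  obtain M u where M: "hom M" "card (kernel M) \<le> card (kernel (\<lambda>x. x)) * 2 ^ u" "supp (coeff f) \<subseteq> kernel M"
    "real u \<le> 12 * sqrt (real k) * harm_bound (card ((\<lambda>x. x) ` supp (coeff f) - {\<zero>}))"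
    using fourier_dim_iterate[OF bool_spec_coeff[OF assms(1)] k(1) hom_id] by blast
  have "kernel (\<lambda>x. x) = {\<zero>}" by (auto simp: kernel_def)
  then have card: "card (kernel M) \<le> 2 ^ u" using M(2) by simp
  define m where "m = card ((\<lambda>x. x) ` supp (coeff f) - {\<zero>})"
  have "m \<le> card (supp (coeff f))" unfolding m_def by (intro card_mono) auto
  then have "m \<le> k" using k by simp
  then have "harm_bound m \<le> 1 + ln (real k)" using k by (auto simp: harm_bound_def)
  then have "12 * sqrt (real k) * harm_bound m \<le> 12 * sqrt (real k) * (1 + ln (real k))"
    by (intro mult_left_mono) auto
  then have "real u \<le> 12 * sqrt (real k) * (1 + ln (real k))" using M(4) by (simp add: m_def)
  then show ?thesis using that[OF kernel_subgrp[OF M(1)] card M(3)] by blast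
qed

end

section \<open>Coding sparse ternary functions\<close>

text \<open>Because \<open>X\<close> squares to 1, the quadratic bound on the exponential is affine
  in \<open>X\<close>, so its expectation depends only on the mean. The bound on \<open>s\<close>
  keeps the exponent within [-1, 1].\<close>

lemma exp_moment_sign:
  fixes w X :: "'b \<Rightarrow> real"
  assumes fin: "finite \<Omega>" and w: "\<And>\<omega>. \<omega> \<in> \<Omega> \<Longrightarrow> 0 \<le> w \<omega>" "(\<Sum>\<omega>\<in>\<Omega>. w \<omega>) = 1"
    and X: "\<And>\<omega>. \<omega> \<in> \<Omega> \<Longrightarrow> X \<omega> = 1 \<or> X \<omega> = -1" and mean: "(\<Sum>\<omega>\<in>\<Omega>. w \<omega> * X \<omega>) = \<mu>"
    and s: "\<bar>s\<bar> \<le> 1 / 2"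
  shows "(\<Sum>\<omega>\<in>\<Omega>. w \<omega> * exp (s * (X \<omega> - \<mu>))) \<le> exp (s\<^sup>2)"
proof -
  have "\<bar>\<mu>\<bar> \<le> (\<Sum>\<omega>\<in>\<Omega>. \<bar>w \<omega> * X \<omega>\<bar>)" unfolding mean[symmetric] by (rule sum_abs)
  also have "\<dots> = (\<Sum>\<omega>\<in>\<Omega>. w \<omega>)" using w(1) X by (intro sum.cong refl) (fastforce simp: abs_mult)
  finally have mu: "\<bar>\<mu>\<bar> \<le> 1" using w(2) by simp
  have "(\<Sum>\<omega>\<in>\<Omega>. w \<omega> * exp (s * (X \<omega> - \<mu>))) \<le>
      (\<Sum>\<omega>\<in>\<Omega>. w \<omega> * ((1 - s * \<mu> + s\<^sup>2 * (1 + \<mu>\<^sup>2)) + (s - 2 * s\<^sup>2 * \<mu>) * X \<omega>))"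
  proof (rule sum_mono)
    fix \<omega> assume o: "\<omega> \<in> \<Omega>"
    have "\<bar>X \<omega> - \<mu>\<bar> \<le> 2" using X[OF o] mu by auto
    then have "\<bar>s\<bar> * \<bar>X \<omega> - \<mu>\<bar> \<le> 1 / 2 * 2" using s by (intro mult_mono) auto
    then have "exp (s * (X \<omega> - \<mu>)) \<le> 1 + s * (X \<omega> - \<mu>) + (s * (X \<omega> - \<mu>))\<^sup>2"
      by (intro exp_le_quadratic) (simp add: abs_mult)
    also have "\<dots> = (1 - s * \<mu> + s\<^sup>2 * (1 + \<mu>\<^sup>2)) + (s - 2 * s\<^sup>2 * \<mu>) * X \<omega>"
      using X[OF o] by (auto simp: power2_eq_square algebra_simps)
    finally show "w \<omega> * exp (s * (X \<omega> - \<mu>)) \<le>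
        w \<omega> * ((1 - s * \<mu> + s\<^sup>2 * (1 + \<mu>\<^sup>2)) + (s - 2 * s\<^sup>2 * \<mu>) * X \<omega>)"
      using w(1)[OF o] by (intro mult_left_mono)
  qed
  also have "\<dots> = (1 - s * \<mu> + s\<^sup>2 * (1 + \<mu>\<^sup>2)) * (\<Sum>\<omega>\<in>\<Omega>. w \<omega>)
      + (s - 2 * s\<^sup>2 * \<mu>) * (\<Sum>\<omega>\<in>\<Omega>. w \<omega> * X \<omega>)"
    unfolding sum_distrib_left sum.distrib[symmetric]
    by (intro sum.cong refl) (simp add: distrib_left mult_ac)
  also have "\<dots> = 1 + s\<^sup>2 - (s * \<mu>)\<^sup>2"
    unfolding w(2) mean by (simp add: power2_eq_square algebra_simps)
  also have "\<dots> \<le> 1 + s\<^sup>2" by simp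
  also have "\<dots> \<le> exp (s\<^sup>2)" by (rule exp_ge_add_one_self)
  finally show ?thesis .
qed

lemma exists_le_average:
  fixes w F :: "'b \<Rightarrow> real"
  assumes fin: "finite \<Omega>" and w: "\<And>\<omega>. \<omega> \<in> \<Omega> \<Longrightarrow> 0 \<le> w \<omega>" "(\<Sum>\<omega>\<in>\<Omega>. w \<omega>) = 1"
    and avg: "(\<Sum>\<omega>\<in>\<Omega>. w \<omega> * F \<omega>) \<le> c"
  shows "\<exists>\<omega>\<in>\<Omega>. F \<omega> \<le> c"
proof -
  have "\<Omega> \<noteq> {}" using w(2) by auto
  then obtain a where a: "a \<in> \<Omega>" "\<And>b. b \<in> \<Omega> \<Longrightarrow> - F b \<le> - F a"
    using finite_has_arg_max[OF fin, of "\<lambda>x. - F x"] by blast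
  have "F a = (\<Sum>\<omega>\<in>\<Omega>. w \<omega> * F a)" using w(2) by (simp add: sum_distrib_right[symmetric])
  also have "\<dots> \<le> (\<Sum>\<omega>\<in>\<Omega>. w \<omega> * F \<omega>)"
    using a(2) w(1) by (intro sum_mono mult_left_mono) auto
  finally show ?thesis using a(1) avg by (intro bexI[of _ a]) auto
qed

lemma sum_powers_seventh: "finite A \<Longrightarrow> 0 \<notin> A \<Longrightarrow> (\<Sum>t\<in>A. (1 / 7 :: real) ^ t) \<le> 1 / 6"
proof -
  assume A: "finite A" "0 \<notin> A"
  obtain n where n: "\<forall>t\<in>A. t \<le> n" using A(1) finite_nat_set_iff_bounded_le by blast
  have "(\<Sum>t\<in>A. (1 / 7 :: real) ^ t) \<le> (\<Sum>t\<in>{1..n}. (1 / 7) ^ t)"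
    using A n by (intro sum_mono2) (auto simp: Suc_le_eq intro: gr0I)
  also have "\<dots> = (1 - (1 / 7) ^ n) / 6" by (induction n) auto
  also have "\<dots> \<le> 1 / 6" by simp
  finally show ?thesis .
qed

context walsh_group
begin

section \<open>Codes made of signed characters\<close>

definition letters :: "'a set \<Rightarrow> (real \<times> 'a) set" where
  "letters W = {-1, 1} \<times> W"

definition char_sum :: "(real \<times> 'a) list \<Rightarrow> 'a \<Rightarrow> real" where
  "char_sum l x = (\<Sum>(e, S)\<leftarrow>l. e * chi S x)"

lemma char_sum_Cons: "char_sum ((e, S) # l) x = e * chi S x + char_sum l x"
  by (simp add: char_sum_def)

text \<open>Maurey's empirical method, derandomised: \<open>g / L\<close> is a convex combination of signed
  characters, and the signed characters of the code are picked one at a time so as not to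
  increase the exponential potential by more than its expected growth.\<close>

lemma empirical_approximation:
  assumes W: "subgrp W" and g: "supp (coeff g) \<subseteq> W"
    and L: "(\<Sum>S\<in>G. \<bar>coeff g S\<bar>) \<le> L" "L > 0" and lam: "\<bar>lam\<bar> \<le> 1 / 2"
  shows "\<exists>l. set l \<subseteq> letters W \<and> length l = t \<and>
    (\<Sum>x\<in>G. exp (lam * (char_sum l x - real t * (g x / L))) + exp (- lam * (char_sum l x - real t * (g x / L))))
      \<le> 2 * N * exp (real t * lam\<^sup>2)"
proof (induction t)
  case 0
  show ?case by (intro exI[of _ "[]"]) (simp add: char_sum_def)
next
  case (Suc t)
  then obtain l where l: "set l \<subseteq> letters W" "length l = t"
    "(\<Sum>x\<in>G. exp (lam * (char_sum l x - real t * (g x / L))) + exp (- lam * (char_sum l x - real t * (g x / L))))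
      \<le> 2 * N * exp (real t * lam\<^sup>2)" by blast
  define \<Omega> where "\<Omega> = letters W"
  define c where "c = coeff g"
  \<comment> \<open>\<open>L\<close> may exceed the \<open>l1\<close>-norm. The missing mass is
    split evenly between the letters \<open>(1, \<zero>)\<close> and \<open>(-1, \<zero>)\<close>,
    which cancel in the mean.\<close>
  define r where "r = (1 - (\<Sum>S\<in>G. \<bar>c S\<bar>) / L) / 2"
  define w where "w \<omega> = (if fst \<omega> * c (snd \<omega>) > 0 then \<bar>c (snd \<omega>)\<bar> / L else 0) + (if snd \<omega> = \<zero> then r else 0)"
    for \<omega> :: "real \<times> 'a"
  have WG: "W \<subseteq> G" and W0: "\<zero> \<in> W" using W by (auto simp: subgrp_def)
  have finW: "finite W" using WG finite_G finite_subset by blast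
  have fin: "finite \<Omega>" using finW by (simp add: \<Omega>_def letters_def)
  have r0: "r \<ge> 0" using L by (simp add: r_def c_def)
  have w0: "0 \<le> w \<omega>" for \<omega> using r0 L by (simp add: w_def)
  have sumO: "(\<Sum>\<omega>\<in>\<Omega>. F \<omega>) = (\<Sum>S\<in>W. F (-1, S) + F (1, S))" for F :: "real \<times> 'a \<Rightarrow> real"
  proof -
    have "(\<Sum>\<omega>\<in>\<Omega>. F \<omega>) = (\<Sum>e\<in>{-1, 1}. \<Sum>S\<in>W. F (e, S))"
      unfolding \<Omega>_def letters_def by (simp add: sum.cartesian_product)
    then show ?thesis by (simp add: sum.distrib)
  qed
  have toW: "(\<Sum>S\<in>G. F (c S) S) = (\<Sum>S\<in>W. F (c S) S)" if "\<And>S. F 0 S = 0" for F :: "real \<Rightarrow> 'a \<Rightarrow> real"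
    using WG g that by (intro sum.mono_neutral_right) (auto simp: supp_def c_def)
  have w1: "(\<Sum>\<omega>\<in>\<Omega>. w \<omega>) = 1"
  proof -
    have "(\<Sum>\<omega>\<in>\<Omega>. w \<omega>) = (\<Sum>S\<in>W. \<bar>c S\<bar> / L + (if S = \<zero> then 2 * r else 0))"
      unfolding sumO by (intro sum.cong refl) (auto simp: w_def)
    also have "\<dots> = (\<Sum>S\<in>G. \<bar>c S\<bar>) / L + 2 * r"
      using W0 finW toW[of "\<lambda>u S. \<bar>u\<bar>"] by (simp add: sum.distrib sum_divide_distrib[symmetric])
    finally have "(\<Sum>\<omega>\<in>\<Omega>. w \<omega>) = (\<Sum>S\<in>G. \<bar>c S\<bar>) / L + 2 * r" .
    moreover have "2 * r = 1 - (\<Sum>S\<in>G. \<bar>c S\<bar>) / L" by (simp add: r_def)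
    ultimately show ?thesis by simp
  qed
  have mean: "(\<Sum>\<omega>\<in>\<Omega>. w \<omega> * (fst \<omega> * chi (snd \<omega>) x)) = g x / L" if x: "x \<in> G" for x
  proof -
    have "(\<Sum>\<omega>\<in>\<Omega>. w \<omega> * (fst \<omega> * chi (snd \<omega>) x)) = (\<Sum>S\<in>W. c S * chi S x / L)"
      unfolding sumO by (intro sum.cong refl) (auto simp: w_def distrib_right left_diff_distrib)
    also have "\<dots> = synth c x / L"
      using toW[of "\<lambda>u S. u * chi S x"] by (simp add: synth_def sum_divide_distrib)
    finally show ?thesis using x by (simp add: c_def synth_coeff)
  qed
  define D where "D l x = char_sum l x - real (length l) * (g x / L)" for l x
  have step: "(\<Sum>\<omega>\<in>\<Omega>. w \<omega> * exp (s * D (\<omega> # l) x)) \<le> exp (lam\<^sup>2) * exp (s * D l x)"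
    if x: "x \<in> G" and s: "s = lam \<or> s = - lam" for s x
  proof -
    have "(\<Sum>\<omega>\<in>\<Omega>. w \<omega> * exp (s * D (\<omega> # l) x)) =
        (\<Sum>\<omega>\<in>\<Omega>. w \<omega> * exp (s * (fst \<omega> * chi (snd \<omega>) x - g x / L))) * exp (s * D l x)"
      unfolding sum_distrib_right
    proof (rule sum.cong[OF refl])
      fix \<omega> :: "real \<times> 'a"
      obtain e S where o: "\<omega> = (e, S)" by force
      have "D (\<omega> # l) x = (e * chi S x - g x / L) + D l x"
        by (simp add: D_def o char_sum_Cons algebra_simps add_divide_distrib)
      then show "w \<omega> * exp (s * D (\<omega> # l) x) =
          w \<omega> * exp (s * (fst \<omega> * chi (snd \<omega>) x - g x / L)) * exp (s * D l x)"
        by (simp add: o distrib_left exp_add)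
    qed
    also have "\<dots> \<le> exp (s\<^sup>2) * exp (s * D l x)"
    proof (rule mult_right_mono[OF exp_moment_sign[OF fin w0 w1 _ mean[OF x]]])
      show "fst \<omega> * chi (snd \<omega>) x = 1 \<or> fst \<omega> * chi (snd \<omega>) x = -1" if "\<omega> \<in> \<Omega>" for \<omega>
        using that chi_cases[of "snd \<omega>" x] x WG by (auto simp: \<Omega>_def letters_def)
    qed (use s lam in auto)
    also have "s\<^sup>2 = lam\<^sup>2" using s by auto
    finally show ?thesis .
  qed
  define Psi where "Psi l = (\<Sum>x\<in>G. exp (lam * D l x) + exp (- lam * D l x))" for l
  \<comment> \<open>A random letter multiplies the expected potential by at most
    \<open>exp (lam^2)\<close>, so some letter does no worse.\<close>
  have "(\<Sum>\<omega>\<in>\<Omega>. w \<omega> * Psi (\<omega> # l)) =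
      (\<Sum>x\<in>G. (\<Sum>\<omega>\<in>\<Omega>. w \<omega> * exp (lam * D (\<omega> # l) x)) + (\<Sum>\<omega>\<in>\<Omega>. w \<omega> * exp (- lam * D (\<omega> # l) x)))"
    unfolding Psi_def sum_distrib_left distrib_left sum.distrib
    by (intro arg_cong2[of _ _ _ _ "(+)"] sum.swap)
  also have "\<dots> \<le> (\<Sum>x\<in>G. exp (lam\<^sup>2) * exp (lam * D l x) + exp (lam\<^sup>2) * exp (- lam * D l x))"
    by (intro sum_mono add_mono step) auto
  also have "\<dots> = exp (lam\<^sup>2) * Psi l" by (simp add: Psi_def sum_distrib_left distrib_left)
  finally obtain \<omega> where o: "\<omega> \<in> \<Omega>" "Psi (\<omega> # l) \<le> exp (lam\<^sup>2) * Psi l"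
    using exists_le_average[OF fin w0 w1, of "\<lambda>\<omega>. Psi (\<omega> # l)"] by blast
  have "Psi l \<le> 2 * N * exp (real t * lam\<^sup>2)" using l by (simp add: Psi_def D_def)
  then have "exp (lam\<^sup>2) * Psi l \<le> exp (lam\<^sup>2) * (2 * N * exp (real t * lam\<^sup>2))" by simp
  also have "\<dots> = 2 * N * exp (real (Suc t) * lam\<^sup>2)" by (simp add: distrib_right exp_add mult_ac)
  finally have "Psi (\<omega> # l) \<le> 2 * N * exp (real (Suc t) * lam\<^sup>2)" using o(2) by simp
  then show ?case
    using o(1) l(1,2) by (intro exI[of _ "\<omega> # l"]) (simp add: Psi_def D_def \<Omega>_def)
qed

definition density :: "('a \<Rightarrow> real) \<Rightarrow> real" where
  "density g = real (card {x \<in> G. g x \<noteq> 0}) / N"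

text \<open>Chosen so that \<open>exp (code_const s / 16) = 9 * s\<close>, which leaves a bad
  fraction of at most \<open>2 / (9 * s)\<close>, below the \<open>1 / (4 * s)\<close> needed for
  decoding.\<close>

definition code_const :: "nat \<Rightarrow> real" where
  "code_const s = 16 * ln (9 * real s)"

text \<open>The scaling depends on the code only through its length, so \<open>s\<close> and
  \<open>l\<close> alone fix the approximation; no knowledge of \<open>g\<close> enters it.\<close>

definition decodes :: "nat \<Rightarrow> (real \<times> 'a) list \<Rightarrow> ('a \<Rightarrow> real) \<Rightarrow> bool" where
  "decodes s l g \<longleftrightarrow>
    4 * real s * real (card {x \<in> G. \<bar>char_sum l x / sqrt (code_const s * real (length l)) - g x\<bar> \<ge> 1 / 2}) < N"

definition ternary :: "('a \<Rightarrow> real) \<Rightarrow> bool" where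
  "ternary g \<longleftrightarrow> (\<forall>x\<in>G. g x = 0 \<or> g x = 1 \<or> g x = -1)"

lemma code_const_ge_1: "s \<ge> 1 \<Longrightarrow> code_const s \<ge> 1"
proof -
  assume s: "s \<ge> 1"
  have "1 \<le> ln (9 * real s)" using s exp_le by (subst ln_ge_iff) auto
  then show ?thesis by (simp add: code_const_def)
qed

lemma sparse_density:
  assumes "card (supp (coeff g)) \<le> s" "\<exists>x\<in>G. g x \<noteq> 0"
  shows "real s * density g \<ge> 1"
  using divide_right_mono[OF uncertainty[OF assms], of N] by (simp add: density_def)

lemma ternary_parseval:
  assumes "ternary g"
  shows "(\<Sum>S\<in>G. (coeff g S)\<^sup>2) = density g"
proof -
  have "(\<Sum>x\<in>G. (g x)\<^sup>2) = (\<Sum>x\<in>G. if g x \<noteq> 0 then 1 else 0)"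
    using assms by (intro sum.cong refl) (auto simp: ternary_def)
  then show ?thesis by (simp add: parseval density_def sum.If_cases Int_def)
qed

text \<open>The squared \<open>l1\<close>-norm is at most \<open>s * density g\<close> by
  Cauchy-Schwarz and Parseval, hence at most \<open>L^2 = t / K\<close>. The empirical method then
  applies, and Markov's inequality for the exponential potential bounds the number of bad
  points.\<close>

lemma code_exists:
  assumes W: "subgrp W" and g: "supp (coeff g) \<subseteq> W" "ternary g" "\<exists>x\<in>G. g x \<noteq> 0"
    and s: "card (supp (coeff g)) \<le> s" "s \<ge> 1" and t: "code_const s * (real s * density g) \<le> real t"
  shows "\<exists>l. set l \<subseteq> letters W \<and> length l = t \<and> decodes s l g"
proof -
  define K where "K = code_const s"
  have K: "K \<ge> 1" using code_const_ge_1 s by (simp add: K_def)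
  define L where "L = sqrt (real t / K)"
  have sd: "1 \<le> real s * density g" using sparse_density[OF s(1) g(3)] .
  have tK: "real s * density g \<le> real t / K" using t K by (simp add: K_def field_simps)
  have L1: "L \<ge> 1" using sd tK by (simp add: L_def)
  have t0: "real t > 0" using tK sd K by (metis divide_le_0_iff le_less_trans less_eq_real_def not_le not_one_le_zero of_nat_0_le_iff order.trans)
  have Lsq: "L * L = real t / K" using K by (simp add: L_def)
  have l1: "(\<Sum>S\<in>G. \<bar>coeff g S\<bar>) \<le> L"
    unfolding L_def
    by (rule real_le_rsqrt) (use l1_squared_le[OF s(1)] ternary_parseval[OF g(2)] tK in simp)
  \<comment> \<open>With this choice the potential grows by \<open>exp (K / 16)\<close> in total,
    while a bad point alone contributes at least \<open>exp (K / 8)\<close>.\<close>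
  define lam where "lam = 1 / (4 * L)"
  have lam: "\<bar>lam\<bar> \<le> 1 / 2" "lam > 0" using L1 by (auto simp: lam_def field_simps)
  have "L > 0" using L1 by simp
  from empirical_approximation[OF W g(1) l1 this lam(1)]
  obtain l where l: "set l \<subseteq> letters W" "length l = t"
    "(\<Sum>x\<in>G. exp (lam * (char_sum l x - real t * (g x / L))) + exp (- lam * (char_sum l x - real t * (g x / L))))
      \<le> 2 * N * exp (real t * lam\<^sup>2)"
    by blast
  define D where "D x = char_sum l x - real t * (g x / L)" for x
  define bad where "bad = {x \<in> G. \<bar>char_sum l x / sqrt (K * real t) - g x\<bar> \<ge> 1 / 2}"
  have sq: "sqrt (K * real t) = real t / L"
  proof -
    have "sqrt (K * real t) * L = sqrt (real t * real t)"
      using K by (simp add: L_def real_sqrt_mult[symmetric])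
    then show ?thesis using L1 by (simp add: field_simps)
  qed
  have e1: "real t * lam\<^sup>2 = K / 16" "lam * (real t / (2 * L)) = K / 8"
    using Lsq K t0 L1 by (auto simp: lam_def power2_eq_square field_simps)
  have badD: "exp (K / 8) \<le> exp (lam * D x) + exp (- lam * D x)" if x: "x \<in> bad" for x
  proof -
    have "char_sum l x / sqrt (K * real t) - g x = D x * L / real t"
      using t0 L1 by (simp add: sq D_def field_simps)
    then have "1 / 2 \<le> \<bar>D x\<bar> * L / real t" using x t0 L1 by (simp add: bad_def abs_mult)
    then have "real t / (2 * L) \<le> \<bar>D x\<bar>" using t0 L1 by (simp add: field_simps)
    then have "lam * (real t / (2 * L)) \<le> lam * \<bar>D x\<bar>" using lam by (intro mult_left_mono) auto
    then have "exp (K / 8) \<le> exp (lam * \<bar>D x\<bar>)" unfolding e1 by simp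
    also have "\<dots> \<le> exp (lam * D x) + exp (- lam * D x)" by (cases "D x \<ge> 0") auto
    finally show ?thesis .
  qed
  have "real (card bad) * exp (K / 8) = (\<Sum>x\<in>bad. exp (K / 8))" by simp
  also have "\<dots> \<le> (\<Sum>x\<in>bad. exp (lam * D x) + exp (- lam * D x))" by (rule sum_mono) (rule badD)
  also have "\<dots> \<le> (\<Sum>x\<in>G. exp (lam * D x) + exp (- lam * D x))"
    by (rule sum_mono2) (auto simp: bad_def add_nonneg_nonneg)
  also have "\<dots> \<le> 2 * N * exp (K / 16)" using l(3) unfolding e1 D_def .
  finally have "real (card bad) * exp (K / 16) * exp (K / 16) \<le> 2 * N * exp (K / 16)"
    by (simp add: mult.assoc exp_add[symmetric])
  then have "real (card bad) * exp (K / 16) \<le> 2 * N" by simp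
  moreover have "exp (K / 16) = 9 * real s" using s by (simp add: K_def code_const_def)
  ultimately have "9 * (real s * real (card bad)) \<le> 2 * N" by (simp add: mult_ac)
  then have "4 * real s * real (card bad) < N" using N_pos unfolding mult.assoc by linarith
  then show ?thesis using l(1,2) by (intro exI[of _ l]) (simp add: decodes_def bad_def K_def)
qed

text \<open>Distinct ternary values are at least 1 apart, so \<open>g\<close> and \<open>h\<close>
  differ only where the code is bad for one of them, on less than a fraction
  \<open>1 / (2 * s)\<close> of \<open>G\<close>. Their difference has at most \<open>2 * s\<close>
  coefficients, so by uncertainty it would have to be nonzero on at least that fraction.\<close>

lemma decodes_unique:
  assumes dec: "decodes s l g" "decodes s l h" and gh: "ternary g" "ternary h"
    and s: "card (supp (coeff g)) \<le> s" "card (supp (coeff h)) \<le> s"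
    and x: "x \<in> G"
  shows "g x = h x"
proof (rule ccontr)
  assume ne: "g x \<noteq> h x"
  let ?b = "\<lambda>g. {x \<in> G. \<bar>char_sum l x / sqrt (code_const s * real (length l)) - g x\<bar> \<ge> 1 / 2}"
  let ?d = "{x \<in> G. g x - h x \<noteq> 0}"
  have "supp (coeff (\<lambda>x. g x - h x)) \<subseteq> supp (coeff g) \<union> supp (coeff h)"
    by (auto simp: supp_def coeff_diff)
  then have "card (supp (coeff (\<lambda>x. g x - h x))) \<le> card (supp (coeff g) \<union> supp (coeff h))"
    by (intro card_mono) auto
  also have "\<dots> \<le> 2 * s" using card_Un_le[of "supp (coeff g)" "supp (coeff h)"] s by linarith
  finally have N_le: "N \<le> real (2 * s) * real (card ?d)"
    using uncertainty[of "\<lambda>x. g x - h x" "2 * s"] ne x by auto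
  have "?d \<subseteq> ?b g \<union> ?b h"
  proof
    fix z assume z: "z \<in> ?d"
    then have "\<bar>g z - h z\<bar> \<ge> 1" using gh by (auto simp: ternary_def) (smt (verit))+
    then have "\<bar>y - g z\<bar> \<ge> 1 / 2 \<or> \<bar>y - h z\<bar> \<ge> 1 / 2" for y by linarith
    then show "z \<in> ?b g \<union> ?b h" using z by blast
  qed
  then have "card ?d \<le> card (?b g \<union> ?b h)" by (intro card_mono) auto
  also have "\<dots> \<le> card (?b g) + card (?b h)" by (rule card_Un_le)
  finally have "real (card ?d) \<le> real (card (?b g)) + real (card (?b h))"
    unfolding of_nat_add[symmetric] by (simp only: of_nat_le_iff)
  then have "real (2 * s) * real (card ?d) \<le> real (2 * s) * (real (card (?b g)) + real (card (?b h)))"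
    by (rule mult_left_mono) simp
  also have "\<dots> < N" using dec by (simp add: decodes_def algebra_simps)
  finally show False using N_le by linarith
qed

text \<open>The number of codes of length \<open>t\<close> is \<open>(2 |W|)^t\<close>, while \<open>t\<close> is proportional to the density
  of the encoded function; so the union bound over \<open>F\<close> converges geometrically.\<close>

lemma sum_exp_density:
  assumes W: "subgrp W" and fin: "finite F" and s: "s \<ge> 1"
    and F: "\<And>g. g \<in> F \<Longrightarrow> supp (coeff g) \<subseteq> W" "\<And>g. g \<in> F \<Longrightarrow> ternary g"
      "\<And>g. g \<in> F \<Longrightarrow> \<exists>x\<in>G. g x \<noteq> 0" "\<And>g. g \<in> F \<Longrightarrow> card (supp (coeff g)) \<le> s"
    and ext: "\<And>g h. g \<in> F \<Longrightarrow> h \<in> F \<Longrightarrow> (\<And>x. x \<in> G \<Longrightarrow> g x = h x) \<Longrightarrow> g = h"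
    and T: "T \<ge> 2 * code_const s * real s * ln (14 * real (card W))"
  shows "(\<Sum>g\<in>F. exp (- (density g * T))) \<le> 1 / 6"
proof -
  define K where "K = code_const s"
  define len where "len g = nat \<lceil>K * (real s * density g)\<rceil>" for g
  define B where "B = real (card W)"
  have K: "K \<ge> 1" using code_const_ge_1 s by (simp add: K_def)
  have finW: "finite W" and Wne: "W \<noteq> {}" using W finite_G finite_subset by (auto simp: subgrp_def)
  then have B: "B \<ge> 1" by (simp add: B_def Suc_leI card_gt_0_iff)
  have Ks: "K * real s > 0" using K s by simp
  \<comment> \<open>Uncertainty makes the ideal code length at least 1, so rounding it up at most
    doubles it and no code is empty.\<close>
  have Kd: "1 \<le> K * (real s * density g)" if "g \<in> F" for g
    using mult_mono[OF K sparse_density[OF F(4)[OF that] F(3)[OF that]]] K by simp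
  have len_ge: "K * (real s * density g) \<le> real (len g)" for g
    unfolding len_def by linarith
  have len_le: "real (len g) \<le> 2 * (K * (real s * density g))" if "g \<in> F" for g
    using Kd[OF that] unfolding len_def by linarith
  have "\<exists>l. set l \<subseteq> letters W \<and> length l = len g \<and> decodes s l g" if "g \<in> F" for g
    using code_exists[OF W F(1)[OF that] F(2)[OF that] F(3)[OF that] F(4)[OF that] s] len_ge[of g] by (simp add: K_def)
  then obtain code where code: "\<And>g. g \<in> F \<Longrightarrow> set (code g) \<subseteq> letters W \<and> length (code g) = len g \<and> decodes s (code g) g"
    by metis
  have inj: "inj_on code F"
  proof (rule inj_onI)
    fix g h assume gh: "g \<in> F" "h \<in> F" "code g = code h"
    show "g = h"
      by (rule ext[OF gh(1,2)], rule decodes_unique[of s "code g"]) (use code[of g] code[of h] gh F in auto)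
  qed
  have count: "real (card {g \<in> F. len g = t}) \<le> (2 * B) ^ t" for t
  proof -
    have "card {g \<in> F. len g = t} \<le> card {l. set l \<subseteq> letters W \<and> length l = t}"
    proof (rule card_inj_on_le)
      show "inj_on code {g \<in> F. len g = t}" using inj by (rule inj_on_subset) auto
      show "code ` {g \<in> F. len g = t} \<subseteq> {l. set l \<subseteq> letters W \<and> length l = t}" using code by auto
      show "finite {l. set l \<subseteq> letters W \<and> length l = t}"
        using finW by (intro finite_lists_length_eq) (simp add: letters_def)
    qed
    also have "\<dots> = card (letters W) ^ t" using finW by (intro card_lists_length_eq) (simp add: letters_def)
    also have "card (letters W) = 2 * card W" by (simp add: letters_def card_cartesian_product)
    finally have "real (card {g \<in> F. len g = t}) \<le> real ((2 * card W) ^ t)" by (simp only: of_nat_le_iff)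
    then show ?thesis by (simp add: B_def)
  qed
  \<comment> \<open>\<open>T\<close> pays \<open>ln (14 * B)\<close> per letter. Against the
    \<open>2 * B\<close> choices for a letter this leaves the ratio 1/7, and the geometric series
    from exponent 1 sums to 1/6.\<close>
  have le: "exp (- (density g * T)) \<le> (1 / (14 * B)) ^ len g" if g: "g \<in> F" for g
  proof -
    have d0: "density g \<ge> 0" by (simp add: density_def)
    have ln0: "ln (14 * B) \<ge> 0" using B by simp
    have "real (len g) * ln (14 * B) \<le> 2 * (K * (real s * density g)) * ln (14 * B)"
      using len_le[OF g] ln0 by (rule mult_right_mono)
    also have "\<dots> = density g * (2 * K * real s * ln (14 * B))" by simp
    also have "\<dots> \<le> density g * T" using T d0 unfolding K_def B_def by (rule mult_left_mono)
    finally have "exp (- (density g * T)) \<le> exp (real (len g) * - ln (14 * B))" by simp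
    also have "\<dots> = exp (- ln (14 * B)) ^ len g" by (rule exp_of_nat_mult)
    also have "exp (- ln (14 * B)) = 1 / (14 * B)" using B by (simp add: exp_minus inverse_eq_divide)
    finally show ?thesis .
  qed
  have "(\<Sum>g\<in>F. exp (- (density g * T))) \<le> (\<Sum>g\<in>F. (1 / (14 * B)) ^ len g)"
    by (rule sum_mono) (rule le)
  also have "\<dots> = (\<Sum>t\<in>len ` F. \<Sum>g | g \<in> F \<and> len g = t. (1 / (14 * B)) ^ len g)"
    using fin by (intro sum.group[symmetric]) auto
  also have "\<dots> = (\<Sum>t\<in>len ` F. real (card {g \<in> F. len g = t}) * (1 / (14 * B)) ^ t)"
    by (intro sum.cong refl) simp
  also have "\<dots> \<le> (\<Sum>t\<in>len ` F. (2 * B) ^ t * (1 / (14 * B)) ^ t)"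
    using B by (intro sum_mono mult_right_mono count) auto
  also have "\<dots> = (\<Sum>t\<in>len ` F. (1 / 7) ^ t)"
    using B by (simp only: power_mult_distrib[symmetric]) simp
  also have "\<dots> \<le> 1 / 6"
  proof (rule sum_powers_seventh)
    show "0 \<notin> len ` F"
    proof
      assume "0 \<in> len ` F"
      then obtain g where "g \<in> F" "len g = 0" by auto
      then show False using len_ge[of g] Kd[of g] by simp
    qed
  qed (use fin in simp)
  finally show ?thesis .
qed

end

section \<open>Product measurements\<close>

lemma union_bound:
  fixes p :: "'b \<Rightarrow> real"
  assumes fin: "finite \<Omega>" "finite F" and p: "\<And>x. x \<in> \<Omega> \<Longrightarrow> 0 \<le> p x"
    and cover: "\<And>x. x \<in> \<Omega> \<Longrightarrow> Q x \<Longrightarrow> \<exists>i\<in>F. A i x"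
  shows "(\<Sum>x | x \<in> \<Omega> \<and> Q x. p x) \<le> (\<Sum>i\<in>F. \<Sum>x | x \<in> \<Omega> \<and> A i x. p x)"
proof -
  have "(\<Sum>x | x \<in> \<Omega> \<and> Q x. p x) = (\<Sum>x\<in>\<Omega>. if Q x then p x else 0)"
    using fin by (simp add: sum.If_cases Int_def)
  also have "\<dots> \<le> (\<Sum>x\<in>\<Omega>. \<Sum>i\<in>F. if A i x then p x else 0)"
  proof (rule sum_mono)
    fix x assume x: "x \<in> \<Omega>"
    show "(if Q x then p x else 0) \<le> (\<Sum>i\<in>F. if A i x then p x else 0)"
    proof (cases "Q x")
      case True
      then obtain i where i: "i \<in> F" "A i x" using cover x by blast
      have "(if A i x then p x else 0) \<le> (\<Sum>i\<in>F. if A i x then p x else 0)"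
        using i fin p x by (intro member_le_sum) auto
      then show ?thesis using True i by simp
    next
      case False
      then show ?thesis using p x by (auto intro!: sum_nonneg)
    qed
  qed
  also have "\<dots> = (\<Sum>i\<in>F. \<Sum>x\<in>\<Omega>. if A i x then p x else 0)" by (rule sum.swap)
  also have "\<dots> = (\<Sum>i\<in>F. \<Sum>x | x \<in> \<Omega> \<and> A i x. p x)"
    using fin by (simp add: sum.If_cases Int_def)
  finally show ?thesis .
qed

text \<open>Independence of the registers: the mass factorises, and a register outside
  \<open>J\<close> contributes its total mass 1.\<close>

lemma sum_product_event:
  fixes P :: "nat \<Rightarrow> 'i \<Rightarrow> real"
  assumes fin: "finite B" and J: "J \<subseteq> {..<T}" and one: "\<And>t. t < T \<Longrightarrow> (\<Sum>b\<in>B. P t b) = 1"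
  shows "(\<Sum>\<omega> | \<omega> \<in> tensor_basis T B \<and> (\<forall>t\<in>J. A (\<omega> t)). \<Prod>t<T. P t (\<omega> t)) =
    (\<Prod>t\<in>J. \<Sum>b | b \<in> B \<and> A b. P t b)"
proof -
  let ?C = "\<lambda>t. if t \<in> J then {b \<in> B. A b} else B"
  have mem: "\<omega> \<in> Pi\<^sub>E {..<T} F \<longleftrightarrow> (\<forall>t<T. \<omega> t \<in> F t) \<and> (\<forall>t. \<not> t < T \<longrightarrow> \<omega> t = undefined)"
    for \<omega> :: "nat \<Rightarrow> 'i" and F
    by (auto simp: PiE_iff extensional_def)
  have C: "x \<in> ?C t \<longleftrightarrow> x \<in> B \<and> (t \<in> J \<longrightarrow> A x)" for x t by simp
  have "{\<omega>. \<omega> \<in> tensor_basis T B \<and> (\<forall>t\<in>J. A (\<omega> t))} = Pi\<^sub>E {..<T} ?C"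
    unfolding set_eq_iff mem_Collect_eq tensor_basis_def mem C using J by blast
  then have "(\<Sum>\<omega> | \<omega> \<in> tensor_basis T B \<and> (\<forall>t\<in>J. A (\<omega> t)). \<Prod>t<T. P t (\<omega> t)) =
      (\<Prod>t<T. \<Sum>b\<in>?C t. P t b)"
    using fin by (simp add: prod_sum_PiE)
  also have "\<dots> = (\<Prod>t\<in>J. \<Sum>b\<in>?C t. P t b)"
    using J one by (intro prod.mono_neutral_right) auto
  also have "\<dots> = (\<Prod>t\<in>J. \<Sum>b | b \<in> B \<and> A b. P t b)" by (intro prod.cong) auto
  finally show ?thesis .
qed

text \<open>Row \<open>b\<close> of \<open>\<phi> t\<close> is a real vector of a measurement basis
  for register \<open>t\<close>. The effect of \<open>y\<close> is the sum of the rank-one operators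
  of the product vectors whose outcome string is decoded to \<open>y\<close>, so classical
  postprocessing is part of the POVM.\<close>

definition product_measurement ::
  "nat \<Rightarrow> 'i set \<Rightarrow> (nat \<Rightarrow> 'i \<Rightarrow> 'i \<Rightarrow> real) \<Rightarrow> ((nat \<Rightarrow> 'i) \<Rightarrow> 'y) \<Rightarrow>
    'y \<Rightarrow> (nat \<Rightarrow> 'i) \<Rightarrow> (nat \<Rightarrow> 'i) \<Rightarrow> complex" where
  "product_measurement T B \<phi> dec y i j =
    (\<Sum>\<omega> | \<omega> \<in> tensor_basis T B \<and> dec \<omega> = y.
      complex_of_real ((\<Prod>t<T. \<phi> t (\<omega> t) (i t)) * (\<Prod>t<T. \<phi> t (\<omega> t) (j t))))"

lemma finite_tensor_basis: "finite B \<Longrightarrow> finite (tensor_basis T B)"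
  by (simp add: tensor_basis_def finite_PiE)

text \<open>The rank-one form turns the quadratic form into a sum of squared amplitudes, which gives
  both positivity and the Born rule.\<close>

lemma quad_form_product_measurement:
  fixes T B \<phi>
  defines "amp \<equiv> (\<lambda>v \<omega>. \<Sum>i\<in>tensor_basis T B. complex_of_real (\<Prod>t<T. \<phi> t (\<omega> t) (i t)) * v i)"
  shows "quad_form (tensor_basis T B) (product_measurement T B \<phi> dec y) v =
    complex_of_real (\<Sum>\<omega> | \<omega> \<in> tensor_basis T B \<and> dec \<omega> = y. (cmod (amp v \<omega>))\<^sup>2)"
proof -
  let ?T = "tensor_basis T B" and ?O = "{\<omega>. \<omega> \<in> tensor_basis T B \<and> dec \<omega> = y}"
  let ?p = "\<lambda>\<omega> i. complex_of_real (\<Prod>t<T. \<phi> t (\<omega> t) (i t))"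
  have "quad_form ?T (product_measurement T B \<phi> dec y) v =
      (\<Sum>i\<in>?T. \<Sum>j\<in>?T. \<Sum>\<omega>\<in>?O. (cnj (v i) * ?p \<omega> i) * (?p \<omega> j * v j))"
    unfolding quad_form_def product_measurement_def
    by (simp add: sum_distrib_left sum_distrib_right mult.assoc)
  also have "\<dots> = (\<Sum>i\<in>?T. \<Sum>\<omega>\<in>?O. \<Sum>j\<in>?T. (cnj (v i) * ?p \<omega> i) * (?p \<omega> j * v j))"
    by (intro sum.cong refl sum.swap)
  also have "\<dots> = (\<Sum>\<omega>\<in>?O. \<Sum>i\<in>?T. \<Sum>j\<in>?T. (cnj (v i) * ?p \<omega> i) * (?p \<omega> j * v j))"
    by (rule sum.swap)
  also have "\<dots> = (\<Sum>\<omega>\<in>?O. cnj (amp v \<omega>) * amp v \<omega>)"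
    unfolding amp_def cnj_sum sum_product
    by (intro sum.cong refl) (simp add: mult.commute)
  also have "\<dots> = complex_of_real (\<Sum>\<omega>\<in>?O. (cmod (amp v \<omega>))\<^sup>2)"
    unfolding of_real_sum
    by (intro sum.cong refl) (metis complex_norm_square mult.commute of_real_power)
  finally show ?thesis .
qed

lemma povm_product_measurement:
  assumes fin: "finite B" "finite Y" and dec: "\<And>\<omega>. \<omega> \<in> tensor_basis T B \<Longrightarrow> dec \<omega> \<in> Y"
    and complete: "\<And>t i j. t < T \<Longrightarrow> i \<in> B \<Longrightarrow> j \<in> B \<Longrightarrow>
      (\<Sum>b\<in>B. \<phi> t b i * \<phi> t b j) = (if i = j then 1 else 0)"
  shows "povm (tensor_basis T B) Y (product_measurement T B \<phi> dec)"
  unfolding povm_def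
proof (intro conjI ballI)
  show "finite (tensor_basis T B)" using fin by (simp add: finite_tensor_basis)
  show "psd (tensor_basis T B) (product_measurement T B \<phi> dec y)" for y
    unfolding psd_def quad_form_product_measurement nonneg_Reals_of_real_iff
    by (intro allI sum_nonneg zero_le_power2)
next
  fix i j assume i: "i \<in> tensor_basis T B" and j: "j \<in> tensor_basis T B"
  have "(\<Sum>y\<in>Y. product_measurement T B \<phi> dec y i j) =
      (\<Sum>\<omega>\<in>tensor_basis T B. complex_of_real ((\<Prod>t<T. \<phi> t (\<omega> t) (i t)) * (\<Prod>t<T. \<phi> t (\<omega> t) (j t))))"
    unfolding product_measurement_def
    using fin dec by (intro sum.group) (auto simp: finite_tensor_basis)
  also have "\<dots> = complex_of_real (\<Sum>\<omega>\<in>tensor_basis T B. \<Prod>t<T. \<phi> t (\<omega> t) (i t) * \<phi> t (\<omega> t) (j t))"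
    by (simp add: prod.distrib)
  also have "(\<Sum>\<omega>\<in>tensor_basis T B. \<Prod>t<T. \<phi> t (\<omega> t) (i t) * \<phi> t (\<omega> t) (j t)) =
      (\<Prod>t<T. \<Sum>b\<in>B. \<phi> t b (i t) * \<phi> t b (j t))"
    unfolding tensor_basis_def using fin by (intro prod_sum_PiE[symmetric]) auto
  also have "\<dots> = (\<Prod>t<T. if i t = j t then 1 else 0)"
  proof (intro prod.cong refl complete)
    fix t assume "t \<in> {..<T}"
    then show "t < T" "i t \<in> B" "j t \<in> B" using i j by (auto simp: tensor_basis_def)
  qed
  also have "\<dots> = (if i = j then 1 else 0)"
  proof (cases "i = j")
    case False
    then obtain t where "t < T" "i t \<noteq> j t"
      using i j unfolding tensor_basis_def by (metis PiE_ext lessThan_iff)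
    then show ?thesis using False by (auto intro!: prod_zero)
  qed simp
  finally show "(\<Sum>y\<in>Y. product_measurement T B \<phi> dec y i j) = (if i = j then 1 else 0)" by simp
qed (use fin in simp)

text \<open>State and measurement vectors are both products, so each amplitude factorises over the
  registers.\<close>

lemma outcome_prob_product_measurement:
  fixes u :: "'i \<Rightarrow> real"
  assumes fin: "finite B"
  shows "outcome_prob (tensor_basis T B) (product_measurement T B \<phi> dec)
      (tensor_power T (\<lambda>i. complex_of_real (u i))) y =
    (\<Sum>\<omega> | \<omega> \<in> tensor_basis T B \<and> dec \<omega> = y. \<Prod>t<T. (\<Sum>i\<in>B. \<phi> t (\<omega> t) i * u i)\<^sup>2)"
proof -
  have amp: "(\<Sum>i\<in>tensor_basis T B. complex_of_real (\<Prod>t<T. \<phi> t (\<omega> t) (i t)) *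
        tensor_power T (\<lambda>i. complex_of_real (u i)) i) =
      complex_of_real (\<Prod>t<T. \<Sum>i\<in>B. \<phi> t (\<omega> t) i * u i)" for \<omega>
  proof -
    have "(\<Prod>t<T. \<Sum>i\<in>B. \<phi> t (\<omega> t) i * u i) =
        (\<Sum>i\<in>tensor_basis T B. \<Prod>t<T. \<phi> t (\<omega> t) (i t) * u (i t))"
      unfolding tensor_basis_def using fin by (intro prod_sum_PiE) auto
    then show ?thesis by (simp add: tensor_power_def prod.distrib)
  qed
  show ?thesis
    unfolding outcome_prob_def quad_form_product_measurement amp
    by (simp only: norm_of_real power2_abs prod_power_distrib Re_complex_of_real)
qed

section \<open>The learner\<close>

context walsh_group
begin

definition bool_funs :: "('a \<Rightarrow> real) set" where
  "bool_funs = G \<rightarrow>\<^sub>E {-1, 1}"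

definition sparse_funs :: "nat \<Rightarrow> ('a \<Rightarrow> real) set" where
  "sparse_funs k = {f \<in> bool_funs. card (supp (coeff f)) \<le> k}"

definition example_state :: "('a \<Rightarrow> real) \<Rightarrow> 'a \<times> real \<Rightarrow> real" where
  "example_state c i = (if fst i \<in> G \<and> snd i = c (fst i) then 1 / sqrt N else 0)"

text \<open>Row \<open>b\<close> of the measurement basis of register \<open>t\<close>: the Fourier basis on the first
  \<open>m\<close> registers, the computational basis on the others. In the Fourier basis, the outcome
  \<open>(S, -1)\<close> has probability \<open>(coeff c S)\<^sup>2 / 2\<close>, and \<open>(S, 1)\<close> occurs only for \<open>S = \<zero>\<close>.\<close>

definition sampler :: "nat \<Rightarrow> nat \<Rightarrow> 'a \<times> real \<Rightarrow> 'a \<times> real \<Rightarrow> real" where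
  "sampler m t b i = (if t < m
     then chi (fst b) (fst i) * (if snd b = 1 then 1 else snd i) / sqrt (2 * N)
     else if b = i then 1 else 0)"

definition sample_prob :: "('a \<Rightarrow> real) \<Rightarrow> nat \<Rightarrow> nat \<Rightarrow> 'a \<times> real \<Rightarrow> real" where
  "sample_prob c m t b = (if t < m
     then (if snd b = 1 then (if fst b = \<zero> then 1 / 2 else 0) else (coeff c (fst b))\<^sup>2 / 2)
     else (if snd b = c (fst b) then 1 / N else 0))"

text \<open>Lying in the span of the sampled characters is expressed through the annihilator:
  whatever is orthogonal to all samples is orthogonal to the support of \<open>h\<close>. The first
  component of an outcome is a character for \<open>t < m\<close> and a point afterwards.\<close>

definition candidates :: "nat \<Rightarrow> nat \<Rightarrow> (nat \<Rightarrow> 'a \<times> real) \<Rightarrow> ('a \<Rightarrow> real) set" where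
  "candidates k m \<omega> = {h \<in> sparse_funs k.
     (\<forall>z\<in>G. (\<forall>t<m. chi (fst (\<omega> t)) z = 1) \<longrightarrow> (\<forall>S\<in>supp (coeff h). chi S z = 1)) \<and>
     (\<forall>t\<in>{m..<2 * m}. h (fst (\<omega> t)) = snd (\<omega> t))}"

text \<open>When no candidate is left, an arbitrary Boolean function is returned, so that every
  outcome string is decoded into the outcome set of the POVM.\<close>

definition learner_output :: "nat \<Rightarrow> nat \<Rightarrow> (nat \<Rightarrow> 'a \<times> real) \<Rightarrow> 'a \<Rightarrow> real" where
  "learner_output k m \<omega> = (SOME h. h \<in> bool_funs \<and> (candidates k m \<omega> \<noteq> {} \<longrightarrow> h \<in> candidates k m \<omega>))"

section \<open>The outcome distribution of a register\<close>

lemma sum_examples: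
  fixes F :: "'a \<times> real \<Rightarrow> real"
  shows "(\<Sum>b\<in>G \<times> {-1, 1}. F b) = (\<Sum>S\<in>G. F (S, -1) + F (S, 1))"
proof -
  have "(\<Sum>b\<in>G \<times> {-1, 1}. F b) = (\<Sum>S\<in>G. \<Sum>e\<in>{-1, 1}. F (S, e))"
    using sum.cartesian_product[of "\<lambda>S e. F (S, e)" "{-1, 1}" G] by (simp add: case_prod_unfold)
  then show ?thesis by simp
qed

lemma bool_funs_cases: "f \<in> bool_funs \<Longrightarrow> x \<in> G \<Longrightarrow> f x = 1 \<or> f x = -1"
  unfolding bool_funs_def by (drule PiE_mem) auto

lemma bool_funs_eqI: "f \<in> bool_funs \<Longrightarrow> g \<in> bool_funs \<Longrightarrow> (\<And>x. x \<in> G \<Longrightarrow> f x = g x) \<Longrightarrow> f = g"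
  unfolding bool_funs_def by (rule PiE_ext)

lemma sampler_complete:
  assumes i: "i \<in> G \<times> {-1, 1}" and j: "j \<in> G \<times> {-1, 1}"
  shows "(\<Sum>b\<in>G \<times> {-1, 1}. sampler m t b i * sampler m t b j) = (if i = j then 1 else 0)"
proof (cases "t < m")
  case True
  obtain x e y e' where ij: "i = (x, e)" "j = (y, e')" "x \<in> G" "y \<in> G" "e \<in> {-1, 1}" "e' \<in> {-1, 1}"
    using i j by (cases i, cases j) auto
  have sq: "sqrt (2 * N) * sqrt (2 * N) = 2 * N" by simp
  \<comment> \<open>The two labels contribute \<open>1\<close> and \<open>e * e'\<close>, whose sum
    vanishes unless the labels agree; the characters separate the points.\<close>
  have "(\<Sum>b\<in>G \<times> {-1, 1}. sampler m t b i * sampler m t b j) =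
      (\<Sum>S\<in>G. (chi x S * chi y S) * ((1 + e * e') / (2 * N)))"
    unfolding sum_examples
  proof (rule sum.cong[OF refl])
    fix S assume "S \<in> G"
    then show "sampler m t (S, -1) i * sampler m t (S, -1) j + sampler m t (S, 1) i * sampler m t (S, 1) j =
        (chi x S * chi y S) * ((1 + e * e') / (2 * N))"
      using True ij by (simp add: sampler_def sq chi_comm[of S] times_divide_times_eq add_divide_distrib[symmetric] distrib_left mult_ac)
  qed
  also have "\<dots> = (if x = y then N else 0) * ((1 + e * e') / (2 * N))"
    using ij by (simp only: sum_distrib_right[symmetric] sum_chi_chi)
  also have "\<dots> = (if i = j then 1 else 0)" using ij by auto
  finally show ?thesis .
next
  case False
  have "(\<Sum>b\<in>G \<times> {-1, 1}. sampler m t b i * sampler m t b j) =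
      (\<Sum>b\<in>G \<times> {-1, 1}. if b = i then (if i = j then 1 else 0) else 0)"
    using False by (intro sum.cong refl) (auto simp: sampler_def)
  also have "\<dots> = (if i = j then 1 else 0)" using i by (simp add: sum.delta)
  finally show ?thesis .
qed

lemma sampler_amplitude:
  assumes c: "c \<in> bool_funs" and b: "b \<in> G \<times> {-1, 1}"
  shows "(\<Sum>i\<in>G \<times> {-1, 1}. sampler m t b i * example_state c i)\<^sup>2 = sample_prob c m t b"
proof -
  obtain S e where be: "b = (S, e)" "S \<in> G" "e = -1 \<or> e = 1" using b by (cases b) auto
  have amp: "(\<Sum>i\<in>G \<times> {-1, 1}. sampler m t b i * example_state c i) =
      (\<Sum>x\<in>G. sampler m t b (x, c x) / sqrt N)"
    unfolding sum_examples
  proof (rule sum.cong[OF refl])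
    fix x assume "x \<in> G"
    then show "sampler m t b (x, -1) * example_state c (x, -1) + sampler m t b (x, 1) * example_state c (x, 1) =
        sampler m t b (x, c x) / sqrt N"
      using bool_funs_cases[OF c, of x] by (auto simp: example_state_def)
  qed
  show ?thesis
  proof (cases "t < m")
    case True
    have "(\<Sum>x\<in>G. sampler m t b (x, c x) / sqrt N) =
        (\<Sum>x\<in>G. chi S x * (if e = 1 then 1 else c x)) / (sqrt 2 * N)"
      unfolding sum_divide_distrib using True be
      by (intro sum.cong refl) (simp add: sampler_def real_sqrt_mult)
    also have "\<dots> = (if e = 1 then (if S = \<zero> then 1 else 0) else coeff c S) / sqrt 2"
      using be sum_chi[OF be(2)] by (auto simp: coeff_def mult.commute)
    finally show ?thesis
      unfolding amp using True be by (auto simp: sample_prob_def power_divide)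
  next
    case False
    have "(\<Sum>x\<in>G. sampler m t b (x, c x) / sqrt N) = (\<Sum>x\<in>G. if x = S then (if e = c S then 1 / sqrt N else 0) else 0)"
      using False be by (intro sum.cong refl) (auto simp: sampler_def)
    also have "\<dots> = (if e = c S then 1 / sqrt N else 0)" using be by (simp add: sum.delta)
    finally show ?thesis
      unfolding amp using False be by (auto simp: sample_prob_def power_divide)
  qed
qed

lemma sample_prob_nonneg: "sample_prob c m t b \<ge> 0"
  by (simp add: sample_prob_def)

text \<open>The outcome \<open>(\<zero>, 1)\<close>, of probability 1/2, satisfies \<open>A\<close>;
  the outcomes with label -1 share the other half according to the squared coefficients.\<close>

lemma sum_sample_prob_fourier:
  assumes c: "c \<in> bool_funs" and t: "t < m" and A0: "A \<zero>"
  shows "(\<Sum>b | b \<in> G \<times> {-1, 1} \<and> A (fst b). sample_prob c m t b) =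
    1 - (\<Sum>S | S \<in> G \<and> \<not> A S. (coeff c S)\<^sup>2) / 2"
proof -
  have "(\<Sum>b | b \<in> G \<times> {-1, 1} \<and> A (fst b). sample_prob c m t b) =
      (\<Sum>b\<in>G \<times> {-1, 1}. if A (fst b) then sample_prob c m t b else 0)"
    by (rule sum.mono_neutral_cong_left) auto
  also have "\<dots> = (\<Sum>S\<in>G. (coeff c S)\<^sup>2 / 2 - (if \<not> A S then (coeff c S)\<^sup>2 else 0) / 2 + (if S = \<zero> then 1 / 2 else 0))"
    unfolding sum_examples using t A0 by (intro sum.cong refl) (auto simp: sample_prob_def)
  also have "\<dots> = (\<Sum>S\<in>G. (coeff c S)\<^sup>2) / 2 - (\<Sum>S\<in>G. if \<not> A S then (coeff c S)\<^sup>2 else 0) / 2 + 1 / 2"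
    by (simp add: sum.distrib sum_subtractf sum_divide_distrib)
  also have "(\<Sum>S\<in>G. (coeff c S)\<^sup>2) = 1"
    using bool_spec_sum_squares[OF bool_spec_coeff] bool_funs_cases[OF c] by blast
  also have "(\<Sum>S\<in>G. if \<not> A S then (coeff c S)\<^sup>2 else 0) = (\<Sum>S | S \<in> G \<and> \<not> A S. (coeff c S)\<^sup>2)"
    by (rule sum.mono_neutral_cong_right) auto
  finally show ?thesis by simp
qed

lemma sum_sample_prob_examples:
  assumes c: "c \<in> bool_funs" and t: "\<not> t < m"
  shows "(\<Sum>b | b \<in> G \<times> {-1, 1} \<and> A (fst b). sample_prob c m t b) = 1 - real (card {x \<in> G. \<not> A x}) / N"
proof -
  have "(\<Sum>b | b \<in> G \<times> {-1, 1} \<and> A (fst b). sample_prob c m t b) =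
      (\<Sum>b\<in>G \<times> {-1, 1}. if A (fst b) then sample_prob c m t b else 0)"
    by (rule sum.mono_neutral_cong_left) auto
  also have "\<dots> = (\<Sum>x\<in>G. 1 / N - (if \<not> A x then 1 / N else 0))"
    unfolding sum_examples
  proof (rule sum.cong[OF refl])
    fix x assume "x \<in> G"
    then show "(if A (fst (x, -1 :: real)) then sample_prob c m t (x, -1) else 0) +
        (if A (fst (x, 1 :: real)) then sample_prob c m t (x, 1) else 0) = 1 / N - (if \<not> A x then 1 / N else 0)"
      using t bool_funs_cases[OF c, of x] by (auto simp: sample_prob_def)
  qed
  also have "\<dots> = 1 - real (card {x \<in> G. \<not> A x}) / N"
    by (simp add: sum_subtractf sum.If_cases Int_def)
  finally show ?thesis .
qed

lemma sum_sample_prob: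
  assumes "c \<in> bool_funs"
  shows "(\<Sum>b\<in>G \<times> {-1, 1}. sample_prob c m t b) = 1"
  using sum_sample_prob_fourier[OF assms, of t m "\<lambda>_. True"]
    sum_sample_prob_examples[OF assms, of t m "\<lambda>_. True"]
  by (cases "t < m") simp_all

section \<open>Test functions for the two kinds of failure, and correctness of the output\<close>

definition translate_diff :: "('a \<Rightarrow> real) \<Rightarrow> 'a \<Rightarrow> 'a \<Rightarrow> real" where
  "translate_diff c z = (\<lambda>x\<in>G. (c x - c (x \<oplus> z)) / 2)"

definition half_diff :: "('a \<Rightarrow> real) \<Rightarrow> ('a \<Rightarrow> real) \<Rightarrow> 'a \<Rightarrow> real" where
  "half_diff c h = (\<lambda>x\<in>G. (c x - h x) / 2)"

lemma coeff_half_diff: "coeff (half_diff c h) S = (coeff c S - coeff h S) / 2"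
proof -
  have "coeff (half_diff c h) S = coeff (\<lambda>x. (1 / 2) * (c x - h x)) S"
    by (rule coeff_cong) (simp add: half_diff_def)
  then show ?thesis unfolding coeff_scale coeff_diff by simp
qed

text \<open>A translation multiplies each coefficient by a sign, so the half difference keeps
  exactly those with sign -1, unchanged.\<close>

lemma coeff_translate_diff:
  assumes "z \<in> G" "S \<in> G"
  shows "coeff (translate_diff c z) S = (if chi S z = -1 then coeff c S else 0)"
proof -
  have "coeff (translate_diff c z) S = coeff (\<lambda>x. (1 / 2) * (c x - c (x \<oplus> z))) S"
    by (rule coeff_cong) (simp add: translate_diff_def)
  also have "\<dots> = (coeff c S - chi S z * coeff c S) / 2"
    unfolding coeff_scale coeff_diff coeff_translate[OF assms] by simp
  finally show ?thesis using chi_cases[OF assms(2,1)] by auto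
qed

text \<open>If the span of the sampled characters misses part of the support of \<open>c\<close>, then some nonzero
  \<open>translate_diff c z\<close> has no sampled character in its support; if a candidate \<open>h \<noteq> c\<close> is left,
  then \<open>half_diff c h\<close> vanishes on all examples.\<close>

lemma learner_output_correct:
  assumes c: "c \<in> sparse_funs k" and W: "subgrp W" "supp (coeff c) \<subseteq> W"
    and \<omega>: "\<omega> \<in> tensor_basis (2 * m) (G \<times> {-1, 1})"
    and pos: "(\<Prod>t<2 * m. sample_prob c m t (\<omega> t)) \<noteq> 0"
    and span: "\<And>z. z \<in> G \<Longrightarrow> \<exists>x\<in>G. translate_diff c z x \<noteq> 0 \<Longrightarrow> \<exists>t\<in>{..<m}. coeff (translate_diff c z) (fst (\<omega> t)) \<noteq> 0"
    and distinguish: "\<And>h. h \<in> sparse_funs k \<Longrightarrow> h \<noteq> c \<Longrightarrow> supp (coeff h) \<subseteq> W \<Longrightarrow>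
      \<exists>t\<in>{m..<2 * m}. half_diff c h (fst (\<omega> t)) \<noteq> 0"
  shows "learner_output k m \<omega> = c"
proof -
  have posT: "sample_prob c m t (\<omega> t) \<noteq> 0" if "t < 2 * m" for t
    using pos that by auto
  have inG: "fst (\<omega> t) \<in> G" if "t < 2 * m" for t
    using \<omega> that by (auto simp: tensor_basis_def PiE_iff mem_Times_iff)
  have label: "c (fst (\<omega> t)) = snd (\<omega> t)" if "t \<in> {m..<2 * m}" for t
    using posT[of t] that by (auto simp: sample_prob_def split: if_splits)
  \<comment> \<open>A Fourier outcome of positive probability is the zero character or lies in the
    support of \<open>c\<close>.\<close>
  have inW: "fst (\<omega> t) \<in> W" if "t < m" for t
  proof -
    have "fst (\<omega> t) = \<zero> \<or> coeff c (fst (\<omega> t)) \<noteq> 0"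
      using posT[of t] that by (auto simp: sample_prob_def split: if_splits)
    then show ?thesis using W inG[of t] that by (auto simp: subgrp_def supp_def)
  qed
  have "c \<in> candidates k m \<omega>"
    unfolding candidates_def
  proof (intro CollectI conjI ballI impI)
    fix z S assume z: "z \<in> G" "\<forall>t<m. chi (fst (\<omega> t)) z = 1" and S: "S \<in> supp (coeff c)"
    then have SG: "S \<in> G" "coeff c S \<noteq> 0" by (auto simp: supp_def)
    show "chi S z = 1"
    proof (rule ccontr)
      assume "chi S z \<noteq> 1"
      \<comment> \<open>Such a \<open>z\<close> annihilates every sample but not \<open>S\<close>,
        so its test function would be nonzero and yet missed by all samples.\<close>
      then have "coeff (translate_diff c z) S \<noteq> 0"
        using coeff_translate_diff[OF z(1) SG(1)] chi_cases[OF SG(1) z(1)] SG(2) by auto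
      then have "\<exists>x\<in>G. translate_diff c z x \<noteq> 0"
        unfolding coeff_def by (metis (no_types, lifting) div_0 mult_zero_left sum.neutral)
      then obtain t where t: "t < m" "coeff (translate_diff c z) (fst (\<omega> t)) \<noteq> 0"
        using span z(1) by blast
      then show False
        using z coeff_translate_diff[OF z(1) inG[of t]] by auto
    qed
  qed (use c label in auto)
  moreover have "h = c" if h: "h \<in> candidates k m \<omega>" for h
  proof (rule ccontr)
    assume ne: "h \<noteq> c"
    have hs: "h \<in> sparse_funs k" using h by (simp add: candidates_def)
    \<comment> \<open>The samples lie in \<open>W\<close>, so by the double annihilator every
      candidate is supported there too; this keeps the union bound over candidates small.\<close>
    have "supp (coeff h) \<subseteq> W"
    proof
      fix S assume S: "S \<in> supp (coeff h)"
      then have "S \<in> G" by (simp add: supp_def)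
      then show "S \<in> W"
      proof (rule subgrp_separates[OF W(1)])
        fix z assume "z \<in> G" "\<And>w. w \<in> W \<Longrightarrow> chi w z = 1"
        then show "chi S z = 1" using h S inW unfolding candidates_def by blast
      qed
    qed
    then obtain t where t: "t \<in> {m..<2 * m}" "half_diff c h (fst (\<omega> t)) \<noteq> 0"
      using distinguish[OF hs ne] by blast
    then have "h (fst (\<omega> t)) = c (fst (\<omega> t))" using h label by (auto simp: candidates_def)
    then show False using t inG[of t] by (simp add: half_diff_def)
  qed
  ultimately have eq: "candidates k m \<omega> = {c}" by blast
  have "c \<in> bool_funs" using c by (simp add: sparse_funs_def)
  then have "learner_output k m \<omega> \<in> bool_funs \<and>
      (candidates k m \<omega> \<noteq> {} \<longrightarrow> learner_output k m \<omega> \<in> candidates k m \<omega>)"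
    unfolding learner_output_def by (rule_tac someI[of _ c]) (simp add: eq)
  then show ?thesis by (simp add: eq)
qed

lemma learner_output_in: "learner_output k m \<omega> \<in> bool_funs"
proof -
  have "(\<lambda>x\<in>G. 1) \<in> bool_funs" by (auto simp: bool_funs_def)
  then have "\<exists>h. h \<in> bool_funs \<and> (candidates k m \<omega> \<noteq> {} \<longrightarrow> h \<in> candidates k m \<omega>)"
    unfolding candidates_def sparse_funs_def by blast
  then show ?thesis unfolding learner_output_def by (rule someI2_ex) simp
qed

text \<open>The tests against translates and those against other candidates each fail with total
  probability at most 1/6.\<close>

lemma success_probability:
  assumes c: "c \<in> sparse_funs k" and k: "k \<ge> 1"
    and m: "real m \<ge> 4 * code_const (2 * k) * real (2 * k) * (ln 14 + 12 * sqrt (real k) * (1 + ln (real k)))"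
  shows "(\<Sum>\<omega> | \<omega> \<in> tensor_basis (2 * m) (G \<times> {-1, 1}) \<and> learner_output k m \<omega> = c.
    \<Prod>t<2 * m. sample_prob c m t (\<omega> t)) \<ge> 2 / 3"
proof -
  let ?B = "G \<times> {-1, 1 :: real}"
  let ?\<Omega> = "tensor_basis (2 * m) ?B"
  define P where "P \<omega> = (\<Prod>t<2 * m. sample_prob c m t (\<omega> t))" for \<omega>
  have cb: "c \<in> bool_funs" and ck: "card (supp (coeff c)) \<le> k" using c by (auto simp: sparse_funs_def)
  have finB: "finite ?B" by simp
  have fin\<Omega>: "finite ?\<Omega>" using finB by (rule finite_tensor_basis)
  have P0: "P \<omega> \<ge> 0" for \<omega> unfolding P_def by (intro prod_nonneg) (simp add: sample_prob_nonneg)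
  obtain W u where W: "subgrp W" "card W \<le> 2 ^ u" "supp (coeff c) \<subseteq> W"
    "real u \<le> 12 * sqrt (real k) * (1 + ln (real k))"
    by (rule fourier_dim[OF bool_funs_cases[OF cb] ck k]) auto
  \<comment> \<open>A test of density \<open>d\<close> fails with probability at most
    \<open>exp (- d * m / 2)\<close>, so \<open>m / 2\<close> plays the role of \<open>T\<close> in
    the counting bound, with sparsity \<open>2 * k\<close> for the half differences.\<close>
  have T: "real m / 2 \<ge> 2 * code_const (2 * k) * real (2 * k) * ln (14 * real (card W))"
  proof -
    have W0: "card W > 0"
      using W(1) finite_G finite_subset by (auto simp: subgrp_def card_gt_0_iff)
    have "real (card W) \<le> 2 ^ u" using W(2) by (metis of_nat_le_iff of_nat_numeral of_nat_power)
    then have "ln (real (card W)) \<le> ln (2 ^ u)" using W0 by simp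
    also have "\<dots> = real u * ln 2" by (simp add: ln_realpow)
    also have "\<dots> \<le> real u * 1" using ln_le_minus_one[of "2::real"] by (intro mult_left_mono) auto
    finally have "ln (14 * real (card W)) \<le> ln 14 + 12 * sqrt (real k) * (1 + ln (real k))"
      using W(4) W0 by (simp add: ln_mult)
    then have "2 * code_const (2 * k) * real (2 * k) * ln (14 * real (card W)) \<le>
        2 * code_const (2 * k) * real (2 * k) * (ln 14 + 12 * sqrt (real k) * (1 + ln (real k)))"
      using code_const_ge_1[of "2 * k"] k by (intro mult_left_mono) auto
    then show ?thesis using m by simp
  qed
  have s: "2 * k \<ge> 1" using k by simp
  \<comment> \<open>The union runs over functions and not over shifts \<open>z\<close>: many shifts
    may give the same test, and counting them separately would bring in the size of
    \<open>G\<close>.\<close>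
  define F1 where "F1 = {g. \<exists>z\<in>G. g = translate_diff c z \<and> (\<exists>x\<in>G. g x \<noteq> 0)}"
  define F2 where "F2 = {g. \<exists>h\<in>sparse_funs k. h \<noteq> c \<and> supp (coeff h) \<subseteq> W \<and> g = half_diff c h}"
  have F1_image: "F1 \<subseteq> translate_diff c ` G" by (auto simp: F1_def)
  have F2_image: "F2 \<subseteq> half_diff c ` bool_funs" by (auto simp: F2_def sparse_funs_def)
  have "finite bool_funs" unfolding bool_funs_def by (intro finite_PiE) auto
  then have fin2: "finite F2" by (intro finite_subset[OF F2_image]) simp
  have fin1: "finite F1" by (intro finite_subset[OF F1_image]) simp
  have F1: "supp (coeff g) \<subseteq> W \<and> ternary g \<and> (\<exists>x\<in>G. g x \<noteq> 0) \<and> card (supp (coeff g)) \<le> 2 * k"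
    if "g \<in> F1" for g
  proof -
    have "\<exists>z\<in>G. g = translate_diff c z \<and> (\<exists>x\<in>G. g x \<noteq> 0)"
      using that by (simp only: F1_def mem_Collect_eq)
    then obtain z where z0: "z \<in> G" "g = translate_diff c z \<and> (\<exists>x\<in>G. g x \<noteq> 0)" by (rule bexE)
    note z = z0(1) z0(2)[THEN conjunct1] z0(2)[THEN conjunct2]
    have sub: "supp (coeff g) \<subseteq> supp (coeff c)"
      using z by (auto simp: supp_def coeff_translate_diff split: if_splits)
    then have "card (supp (coeff g)) \<le> card (supp (coeff c))" by (intro card_mono) auto
    moreover have "ternary g"
      unfolding ternary_def
    proof
      fix x assume x: "x \<in> G"
      then show "g x = 0 \<or> g x = 1 \<or> g x = - 1"
        using bool_funs_cases[OF cb x] bool_funs_cases[OF cb add_in[OF x z(1)]]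
        by (auto simp: z(2) translate_diff_def)
    qed
    ultimately show ?thesis using sub W(3) ck z(3) by auto
  qed
  have F2: "supp (coeff g) \<subseteq> W \<and> ternary g \<and> (\<exists>x\<in>G. g x \<noteq> 0) \<and> card (supp (coeff g)) \<le> 2 * k"
    if "g \<in> F2" for g
  proof -
    have "\<exists>h\<in>sparse_funs k. h \<noteq> c \<and> supp (coeff h) \<subseteq> W \<and> g = half_diff c h"
      using that by (simp only: F2_def mem_Collect_eq)
    then obtain h where h0: "h \<in> sparse_funs k" "h \<noteq> c \<and> supp (coeff h) \<subseteq> W \<and> g = half_diff c h"
      by (rule bexE)
    then have h: "h \<in> bool_funs" "card (supp (coeff h)) \<le> k" "h \<noteq> c" "supp (coeff h) \<subseteq> W" "g = half_diff c h"
      by (simp_all add: sparse_funs_def)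
    have sub: "supp (coeff g) \<subseteq> supp (coeff c) \<union> supp (coeff h)"
      by (auto simp: supp_def h(5) coeff_half_diff)
    then have "card (supp (coeff g)) \<le> card (supp (coeff c) \<union> supp (coeff h))" by (intro card_mono) auto
    also have "\<dots> \<le> 2 * k" using card_Un_le[of "supp (coeff c)" "supp (coeff h)"] ck h(2) by linarith
    finally have "card (supp (coeff g)) \<le> 2 * k" .
    moreover have "ternary g"
      unfolding ternary_def
    proof
      fix x assume x: "x \<in> G"
      then show "g x = 0 \<or> g x = 1 \<or> g x = - 1"
        using bool_funs_cases[OF cb x] bool_funs_cases[OF h(1) x]
        by (auto simp: h(5) half_diff_def)
    qed
    moreover have "\<exists>x\<in>G. g x \<noteq> 0"
    proof (rule ccontr)
      assume "\<not> ?thesis"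
      then have "c x = h x" if "x \<in> G" for x using that by (simp add: h(5) half_diff_def)
      then show False using bool_funs_eqI[OF cb h(1)] h(3) by blast
    qed
    ultimately show ?thesis using sub W(3) h(4) by blast
  qed
  \<comment> \<open>The tests are undefined outside \<open>G\<close>, so equality on
    \<open>G\<close> is equality and the coding is injective on tests.\<close>
  have "F1 \<union> F2 \<subseteq> extensional G"
    using F1_image F2_image by (auto simp: translate_diff_def half_diff_def)
  then have ext: "g = h" if "g \<in> F1 \<union> F2" "h \<in> F1 \<union> F2" "\<And>x. x \<in> G \<Longrightarrow> g x = h x" for g h
    using that by (meson extensionalityI subsetD)
  have sum1: "(\<Sum>g\<in>F1. exp (- (density g * (real m / 2)))) \<le> 1 / 6"
    by (rule sum_exp_density[OF W(1) fin1 s _ _ _ _ _ T]) (use F1 ext in auto)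
  have sum2: "(\<Sum>g\<in>F2. exp (- (density g * (real m / 2)))) \<le> 1 / 6"
    by (rule sum_exp_density[OF W(1) fin2 s _ _ _ _ _ T]) (use F2 ext in auto)
  have power: "(1 - d) ^ m \<le> exp (- (d * real m))" if "d \<le> 1" for d :: real
  proof -
    have "(1 - d) ^ m \<le> exp (- d) ^ m" using that exp_ge_add_one_self[of "- d"] by (intro power_mono) auto
    also have "\<dots> = exp (- (d * real m))" by (simp add: exp_of_nat_mult[symmetric] mult.commute)
    finally show ?thesis .
  qed
  have d01: "0 \<le> density g \<and> density g \<le> 1" for g
  proof -
    have "card {x \<in> G. g x \<noteq> 0} \<le> card G" by (intro card_mono) auto
    then show ?thesis by (simp add: density_def divide_le_eq)
  qed
  have E1: "(\<Sum>\<omega> | \<omega> \<in> ?\<Omega> \<and> (\<forall>t\<in>{..<m}. coeff g (fst (\<omega> t)) = 0). P \<omega>) \<le> exp (- (density g * (real m / 2)))"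
    if g: "g \<in> F1" for g
  proof -
    obtain z where z: "g = translate_diff c z" "z \<in> G" using g F1_image by (blast elim: imageE)
    have c0: "coeff g \<zero> = 0" using z by (simp add: coeff_translate_diff)
    \<comment> \<open>On its support \<open>g\<close> has the coefficients of \<open>c\<close>, so
      the probability of hitting it is half the energy of \<open>g\<close>, that is, half its
      density.\<close>
    have "(\<Sum>S | S \<in> G \<and> \<not> coeff g S = 0. (coeff c S)\<^sup>2) = (\<Sum>S\<in>G. (coeff g S)\<^sup>2)"
      using z by (intro sum.mono_neutral_cong_left) (auto simp: coeff_translate_diff split: if_splits)
    also have "\<dots> = density g" using F1[OF g] by (intro ternary_parseval) auto
    finally have mass: "(\<Sum>b | b \<in> ?B \<and> coeff g (fst b) = 0. sample_prob c m t b) = 1 - density g / 2" if "t < m" for t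
      using sum_sample_prob_fourier[OF cb that, of "\<lambda>S. coeff g S = 0"] c0 by simp
    have "(\<Sum>\<omega> | \<omega> \<in> ?\<Omega> \<and> (\<forall>t\<in>{..<m}. coeff g (fst (\<omega> t)) = 0). P \<omega>) =
        (\<Prod>t\<in>{..<m}. \<Sum>b | b \<in> ?B \<and> coeff g (fst b) = 0. sample_prob c m t b)"
      unfolding P_def by (rule sum_product_event[OF finB]) (auto simp: sum_sample_prob[OF cb])
    also have "\<dots> = (1 - density g / 2) ^ m" by (simp add: mass)
    also have "\<dots> \<le> exp (- (density g / 2 * real m))" using d01[of g] by (intro power) auto
    finally show ?thesis by simp
  qed
  have E2: "(\<Sum>\<omega> | \<omega> \<in> ?\<Omega> \<and> (\<forall>t\<in>{m..<2 * m}. g (fst (\<omega> t)) = 0). P \<omega>) \<le> exp (- (density g * (real m / 2)))"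
    if g: "g \<in> F2" for g
  proof -
    have "(\<Sum>\<omega> | \<omega> \<in> ?\<Omega> \<and> (\<forall>t\<in>{m..<2 * m}. g (fst (\<omega> t)) = 0). P \<omega>) =
        (\<Prod>t\<in>{m..<2 * m}. \<Sum>b | b \<in> ?B \<and> g (fst b) = 0. sample_prob c m t b)"
      unfolding P_def by (rule sum_product_event[OF finB]) (auto simp: sum_sample_prob[OF cb])
    also have "\<dots> = (\<Prod>t\<in>{m..<2 * m}. 1 - density g)"
      using sum_sample_prob_examples[OF cb, of _ m "\<lambda>x. g x = 0"]
      by (intro prod.cong refl) (auto simp: density_def)
    also have "\<dots> = (1 - density g) ^ m" by simp
    also have "\<dots> \<le> exp (- (density g * real m))" using d01[of g] by (intro power) auto
    \<comment> \<open>A factor 2 in the exponent is given up to share the bound with the Fourier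
      tests.\<close>
    also have "\<dots> \<le> exp (- (density g * (real m / 2)))"
      using d01[of g] by (simp add: mult_left_mono)
    finally show ?thesis .
  qed
  define A where "A i \<omega> = (case i of Inl g \<Rightarrow> \<forall>t\<in>{..<m}. coeff g (fst (\<omega> t)) = 0
    | Inr g \<Rightarrow> \<forall>t\<in>{m..<2 * m}. g (fst (\<omega> t)) = 0)" for i :: "('a \<Rightarrow> real) + ('a \<Rightarrow> real)" and \<omega> :: "nat \<Rightarrow> 'a \<times> real"
  \<comment> \<open>Only outcome strings of positive probability are covered by the correctness
    criterion; the others add nothing.\<close>
  have "(\<Sum>\<omega> | \<omega> \<in> ?\<Omega> \<and> learner_output k m \<omega> \<noteq> c. P \<omega>) =
      (\<Sum>\<omega> | \<omega> \<in> ?\<Omega> \<and> (learner_output k m \<omega> \<noteq> c \<and> P \<omega> \<noteq> 0). P \<omega>)"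
    using fin\<Omega> by (intro sum.mono_neutral_right) auto
  also have "\<dots> \<le> (\<Sum>i\<in>F1 <+> F2. \<Sum>\<omega> | \<omega> \<in> ?\<Omega> \<and> A i \<omega>. P \<omega>)"
  proof (rule union_bound[OF fin\<Omega> _ P0])
    fix \<omega> assume w: "\<omega> \<in> ?\<Omega>" and bad: "learner_output k m \<omega> \<noteq> c \<and> P \<omega> \<noteq> 0"
    show "\<exists>i\<in>F1 <+> F2. A i \<omega>"
    proof (rule ccontr)
      assume none: "\<not> ?thesis"
      have "learner_output k m \<omega> = c"
      proof (rule learner_output_correct[OF c W(1,3) w])
        show "(\<Prod>t<2 * m. sample_prob c m t (\<omega> t)) \<noteq> 0" using bad by (simp add: P_def)
      next
        fix z assume z: "z \<in> G" "\<exists>x\<in>G. translate_diff c z x \<noteq> 0"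
        then have "Inl (translate_diff c z) \<in> F1 <+> F2" by (auto simp: F1_def)
        then have "\<not> A (Inl (translate_diff c z)) \<omega>" using none by blast
        then show "\<exists>t\<in>{..<m}. coeff (translate_diff c z) (fst (\<omega> t)) \<noteq> 0" by (simp add: A_def)
      next
        fix h assume h: "h \<in> sparse_funs k" "h \<noteq> c" "supp (coeff h) \<subseteq> W"
        then have "Inr (half_diff c h) \<in> F1 <+> F2" by (auto simp: F2_def)
        then have "\<not> A (Inr (half_diff c h)) \<omega>" using none by blast
        then show "\<exists>t\<in>{m..<2 * m}. half_diff c h (fst (\<omega> t)) \<noteq> 0" by (simp add: A_def)
      qed
      then show False using bad by blast
    qed
  qed (use fin1 fin2 in simp)
  also have "\<dots> = (\<Sum>g\<in>F1. \<Sum>\<omega> | \<omega> \<in> ?\<Omega> \<and> A (Inl g) \<omega>. P \<omega>) + (\<Sum>g\<in>F2. \<Sum>\<omega> | \<omega> \<in> ?\<Omega> \<and> A (Inr g) \<omega>. P \<omega>)"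
    using fin1 fin2 by (simp only: sum.Plus comp_def)
  also have "\<dots> \<le> (\<Sum>g\<in>F1. exp (- (density g * (real m / 2)))) + (\<Sum>g\<in>F2. exp (- (density g * (real m / 2))))"
    unfolding A_def sum.case by (intro add_mono sum_mono E1 E2)
  also have "\<dots> \<le> 1 / 3" using sum1 sum2 by linarith
  finally have fail: "(\<Sum>\<omega> | \<omega> \<in> ?\<Omega> \<and> learner_output k m \<omega> \<noteq> c. P \<omega>) \<le> 1 / 3" .
  have "(\<Sum>\<omega>\<in>?\<Omega>. P \<omega>) = 1"
    using sum_product_event[OF finB, of "{}" "2 * m" "sample_prob c m" "\<lambda>_. True"]
    by (simp add: P_def sum_sample_prob[OF cb])
  moreover have "(\<Sum>\<omega>\<in>?\<Omega>. P \<omega>) = (\<Sum>\<omega> | \<omega> \<in> ?\<Omega> \<and> learner_output k m \<omega> = c. P \<omega>) +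
      (\<Sum>\<omega> | \<omega> \<in> ?\<Omega> \<and> learner_output k m \<omega> \<noteq> c. P \<omega>)"
    using fin\<Omega> by (subst sum.union_disjoint[symmetric]) (auto intro!: sum.cong)
  ultimately show ?thesis using fail unfolding P_def by linarith
qed

lemma sparse_learner:
  assumes k: "k \<ge> 1"
    and m: "real m \<ge> 4 * code_const (2 * k) * real (2 * k) * (ln 14 + 12 * sqrt (real k) * (1 + ln (real k)))"
  shows "\<exists>E. povm (tensor_basis (2 * m) (G \<times> {-1, 1})) bool_funs E \<and>
    (\<forall>c\<in>sparse_funs k. outcome_prob (tensor_basis (2 * m) (G \<times> {-1, 1})) E
       (tensor_power (2 * m) (\<lambda>i. complex_of_real (example_state c i))) c \<ge> 2 / 3)"
proof (intro exI conjI ballI)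
  let ?E = "product_measurement (2 * m) (G \<times> {-1, 1}) (sampler m) (learner_output k m)"
  have "finite bool_funs" unfolding bool_funs_def by (intro finite_PiE) auto
  then show "povm (tensor_basis (2 * m) (G \<times> {-1, 1})) bool_funs ?E"
    by (intro povm_product_measurement learner_output_in sampler_complete) auto
  fix c assume c: "c \<in> sparse_funs k"
  have "outcome_prob (tensor_basis (2 * m) (G \<times> {-1, 1})) ?E
       (tensor_power (2 * m) (\<lambda>i. complex_of_real (example_state c i))) c =
     (\<Sum>\<omega> | \<omega> \<in> tensor_basis (2 * m) (G \<times> {-1, 1}) \<and> learner_output k m \<omega> = c.
        \<Prod>t<2 * m. (\<Sum>i\<in>G \<times> {-1, 1}. sampler m t (\<omega> t) i * example_state c i)\<^sup>2)"
    by (rule outcome_prob_product_measurement) simp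
  also have "\<dots> = (\<Sum>\<omega> | \<omega> \<in> tensor_basis (2 * m) (G \<times> {-1, 1}) \<and> learner_output k m \<omega> = c.
        \<Prod>t<2 * m. sample_prob c m t (\<omega> t))"
  proof (intro sum.cong prod.cong refl sampler_amplitude)
    show "c \<in> bool_funs" using c by (simp add: sparse_funs_def)
  qed (auto simp: tensor_basis_def PiE_iff)
  also have "\<dots> \<ge> 2 / 3" by (rule success_probability[OF c k m])
  finally show "outcome_prob (tensor_basis (2 * m) (G \<times> {-1, 1})) ?E
       (tensor_power (2 * m) (\<lambda>i. complex_of_real (example_state c i))) c \<ge> 2 / 3" .
qed

end

section \<open>The cube\<close>

definition cube_add :: "nat \<Rightarrow> (nat \<Rightarrow> nat) \<Rightarrow> (nat \<Rightarrow> nat) \<Rightarrow> nat \<Rightarrow> nat" where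
  "cube_add n x y = (\<lambda>i\<in>{..<n}. (x i + y i) mod 2)"

definition cube_zero :: "nat \<Rightarrow> nat \<Rightarrow> nat" where
  "cube_zero n = (\<lambda>i\<in>{..<n}. 0)"

definition cube_chi :: "nat \<Rightarrow> (nat \<Rightarrow> nat) \<Rightarrow> (nat \<Rightarrow> nat) \<Rightarrow> real" where
  "cube_chi n S x = (-1) ^ (\<Sum>i<n. S i * x i)"

lemma cube_bit: "x \<in> cube n \<Longrightarrow> i < n \<Longrightarrow> x i = 0 \<or> x i = 1"
  unfolding cube_def by (drule PiE_mem[of _ _ _ i]) auto

lemma cube_eqI: "x \<in> cube n \<Longrightarrow> y \<in> cube n \<Longrightarrow> (\<And>i. i < n \<Longrightarrow> x i = y i) \<Longrightarrow> x = y"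
  unfolding cube_def by (rule PiE_ext) auto

lemma cube_add_in: "cube_add n x y \<in> cube n"
  by (auto simp: cube_def cube_add_def)

lemma cube_zero_in: "cube_zero n \<in> cube n"
  by (auto simp: cube_def cube_zero_def)

lemma cube_add_apply: "i < n \<Longrightarrow> cube_add n x y i = (x i + y i) mod 2"
  by (simp add: cube_add_def)

lemma cube_zero_apply: "i < n \<Longrightarrow> cube_zero n i = 0"
  by (simp add: cube_zero_def)

lemma card_cube: "card (cube n) = 2 ^ n"
  by (simp add: cube_def card_PiE numeral_2_eq_2)

interpretation cube: walsh_group "cube n" "cube_add n" "cube_zero n" "cube_chi n" for n
proof
  show "finite (cube n)" by (simp add: cube_def finite_PiE)
  show "cube_zero n \<in> cube n" by (rule cube_zero_in)
next
  fix x y z assume xyz: "x \<in> cube n" "y \<in> cube n" "z \<in> cube n"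
  show "cube_add n (cube_add n x y) z = cube_add n x (cube_add n y z)"
    by (rule cube_eqI[OF cube_add_in cube_add_in]) (simp add: cube_add_apply mod_simps add.assoc)
  show "cube_chi n (cube_add n x y) z = cube_chi n x z * cube_chi n y z"
    unfolding cube_chi_def power_sum prod.distrib[symmetric]
  proof (rule prod.cong[OF refl])
    fix i assume "i \<in> {..<n}"
    then have i: "i < n" by simp
    show "(-1 :: real) ^ (cube_add n x y i * z i) = (-1) ^ (x i * z i) * (-1) ^ (y i * z i)"
      using cube_bit[OF xyz(1) i] cube_bit[OF xyz(2) i] cube_bit[OF xyz(3) i]
      by (auto simp: cube_add_apply[OF i])
  qed
next
  fix x y assume xy: "x \<in> cube n" "y \<in> cube n"
  show "cube_add n x y \<in> cube n" by (rule cube_add_in)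
  show "cube_add n x y = cube_add n y x" by (simp add: cube_add_def add.commute)
  show "cube_chi n x y = cube_chi n y x" by (simp add: cube_chi_def mult.commute)
  show "cube_chi n x y = 1 \<or> cube_chi n x y = - 1"
    unfolding cube_chi_def by (cases "even (\<Sum>i<n. x i * y i)") simp_all
next
  fix x assume x: "x \<in> cube n"
  show "cube_add n x (cube_zero n) = x"
  proof (rule cube_eqI[OF cube_add_in x])
    fix i assume "i < n"
    then show "cube_add n x (cube_zero n) i = x i"
      using cube_bit[OF x, of i] by (auto simp: cube_add_apply cube_zero_apply)
  qed
  show "cube_add n x x = cube_zero n"
    by (rule cube_eqI[OF cube_add_in cube_zero_in]) (simp add: cube_add_apply cube_zero_apply)
  assume "x \<noteq> cube_zero n"
  then obtain i where "i < n" "x i \<noteq> cube_zero n i" using cube_eqI[OF x cube_zero_in] by blast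
  then have i: "i < n" "x i = 1" using cube_bit[OF x, of i] by (auto simp: cube_zero_apply)
  define y where "y = (\<lambda>j\<in>{..<n}. if j = i then 1 else 0 :: nat)"
  have "(\<Sum>j<n. x j * y j) = (\<Sum>j<n. if j = i then x i else 0)"
    by (intro sum.cong refl) (auto simp: y_def)
  then have "cube_chi n x y = -1" using i by (simp add: cube_chi_def)
  moreover have "y \<in> cube n" by (auto simp: y_def cube_def)
  ultimately show "\<exists>y\<in>cube n. cube_chi n x y = - 1" by blast
qed

section \<open>Transfer to the stated definitions, and the numerical bound\<close>

lemma fourier_support_eq: "fourier_support n f = cube.supp n (cube.coeff n f)"
  by (simp add: fourier_support_def fourier_coeff_def cube.supp_def cube.coeff_def card_cube cube_chi_def)

lemma boolean_functions_eq: "boolean_functions n = cube.bool_funs n"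
  by (simp add: boolean_functions_def cube.bool_funs_def)

lemma fourier_sparse_eq: "fourier_sparse n k = cube.sparse_funs n k"
  by (simp add: fourier_sparse_def cube.sparse_funs_def boolean_functions_eq fourier_support_eq)

lemma uniform_example_eq: "uniform_example n c = (\<lambda>i. complex_of_real (cube.example_state n c i))"
proof
  fix i :: "(nat \<Rightarrow> nat) \<times> real"
  obtain y e where i: "i = (y, e)" by force
  have "(\<Sum>x\<in>cube n. ket (x, c x) i) = (\<Sum>x\<in>cube n. if x = y then (if e = c y then 1 else 0) else 0)"
    by (intro sum.cong refl) (auto simp: ket_def i)
  then have "(\<Sum>x\<in>cube n. ket (x, c x) i) = (if y \<in> cube n \<and> e = c y then 1 else 0)" by simp
  then show "uniform_example n c i = complex_of_real (cube.example_state n c i)"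
    by (simp add: uniform_example_def cube.example_state_def card_cube i)
qed

text \<open>With \<open>l\<close> at least 1, \<open>ln 18 + ln k\<close> is at most
  \<open>18 * l\<close>, so four times the code constant is at most
  \<open>4 * 16 * 18 * l = 1152 * l\<close>; the last factor is at most
  \<open>(13 + 24) * sqrt k * l\<close>. Finally \<open>1152 * 2 * 37 = 85248\<close>.\<close>

lemma sample_bound:
  fixes k :: nat
  assumes k: "k \<ge> 2"
  defines "l \<equiv> log 2 (real k)"
  shows "4 * cube.code_const (2 * k) * real (2 * k) * (ln 14 + 12 * sqrt (real k) * (1 + ln (real k)))
    \<le> 85248 * (real k * sqrt (real k) * l\<^sup>2)" and "l \<ge> 1"
proof -
  have l1: "l \<ge> 1" using k by (simp add: l_def)
  then show "l \<ge> 1" .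
  have ln2: "ln (2 :: real) \<le> 1" using ln_le_minus_one[of "2::real"] by simp
  have "ln (real k) = l * ln 2" by (simp add: l_def log_def)
  also have "\<dots> \<le> l * 1" using l1 ln2 by (intro mult_left_mono) auto
  finally have lnk: "ln (real k) \<le> l" by simp
  have sq1: "sqrt (real k) \<ge> 1" using k by simp
  have "ln (9 * real (2 * k)) = ln 18 + ln (real k)" using k ln_mult[of 18 "real k"] by simp
  also have "\<dots> \<le> 17 + l" using lnk ln_le_minus_one[of "18::real"] by simp
  also have "\<dots> \<le> 18 * l" using l1 by simp
  finally have "ln (9 * real (2 * k)) \<le> 18 * l" .
  then have K: "4 * cube.code_const (2 * k) \<le> 1152 * l" by (simp add: cube.code_const_def)
  have sl: "1 \<le> sqrt (real k) * l" using mult_mono[OF sq1 l1] sq1 by simp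
  have "ln (14 :: real) + 12 * sqrt (real k) * (1 + ln (real k)) \<le> 13 + 12 * sqrt (real k) * (2 * l)"
    using lnk l1 ln_le_minus_one[of "14::real"] by (intro add_mono mult_left_mono) auto
  also have "\<dots> = 13 + 24 * (sqrt (real k) * l)" by simp
  also have "\<dots> \<le> 37 * (sqrt (real k) * l)" using sl by linarith
  finally have L: "ln (14 :: real) + 12 * sqrt (real k) * (1 + ln (real k)) \<le> 37 * (sqrt (real k) * l)" .
  have "4 * cube.code_const (2 * k) * real (2 * k) * (ln 14 + 12 * sqrt (real k) * (1 + ln (real k)))
      \<le> (1152 * l) * real (2 * k) * (37 * (sqrt (real k) * l))"
    using l1 k by (intro mult_mono[OF mult_mono[OF K order_refl] L] add_nonneg_nonneg mult_nonneg_nonneg) auto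
  also have "\<dots> = 85248 * (real k * sqrt (real k) * l\<^sup>2)" by (simp add: power2_eq_square)
  finally show "4 * cube.code_const (2 * k) * real (2 * k) * (ln 14 + 12 * sqrt (real k) * (1 + ln (real k)))
    \<le> 85248 * (real k * sqrt (real k) * l\<^sup>2)" .
qed

theorem theorem4:
  "\<exists>A::real. A > 0 \<and>
     (\<forall>(n::nat) (k::nat). n > 0 \<and> 2 \<le> k \<and> k \<le> 2 ^ n \<longrightarrow>
        (\<exists>(T::nat) E. real T \<le> A * real k powr (3 / 2) * (log 2 (real k)) ^ 2 \<and>
           quantum_learner n T E \<and>
           exactly_learns n T E (fourier_sparse n k) (2 / 3)))"
proof (intro exI[of _ "170498 :: real"] conjI allI impI)
  fix n k :: nat
  assume nk: "n > 0 \<and> 2 \<le> k \<and> k \<le> 2 ^ n"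
  then have k: "2 \<le> k" "1 \<le> k" by auto
  define R where "R = 4 * cube.code_const (2 * k) * real (2 * k) * (ln 14 + 12 * sqrt (real k) * (1 + ln (real k)))"
  define m where "m = nat \<lceil>R\<rceil>"
  define l where "l = log 2 (real k)"
  have R0: "R \<ge> 0" using k cube.code_const_ge_1[of "2 * k"] by (simp add: R_def)
  have m: "R \<le> real m" "real m \<le> R + 1" using R0 by (auto simp: m_def)
  have l1: "l \<ge> 1" and R: "R \<le> 85248 * (real k * sqrt (real k) * l\<^sup>2)"
    using sample_bound[OF k(1)] by (simp_all add: l_def R_def)
  have "real k powr (3 / 2) = real k powr (1 + 1 / 2)" by simp
  also have "\<dots> = real k * sqrt (real k)" using k by (simp only: powr_add) (simp add: powr_half_sqrt)
  finally have pw: "real k powr (3 / 2) = real k * sqrt (real k)" .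
  \<comment> \<open>The two halves use \<open>2 * m\<close> registers, at most
    \<open>2 * R + 2\<close>. This lower bound absorbs the rounding, whence
    \<open>2 * 85248 + 2 = 170498\<close>.\<close>
  have "1 * 1 * 1\<^sup>2 \<le> real k * sqrt (real k) * l\<^sup>2"
    using k l1 by (intro mult_mono power_mono) auto
  then have T: "real (2 * m) \<le> 170498 * real k powr (3 / 2) * (log 2 (real k))\<^sup>2"
    using m(2) R by (simp add: pw l_def)
  obtain E where E: "povm (tensor_basis (2 * m) (cube n \<times> {-1, 1})) (cube.bool_funs n) E"
    "\<forall>c\<in>cube.sparse_funs n k. outcome_prob (tensor_basis (2 * m) (cube n \<times> {-1, 1})) E
       (tensor_power (2 * m) (\<lambda>i. complex_of_real (cube.example_state n c i))) c \<ge> 2 / 3"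
    using cube.sparse_learner[OF k(2), of m n] m(1) unfolding R_def by blast
  have "quantum_learner n (2 * m) E"
    using E(1) by (simp add: quantum_learner_def example_basis_def boolean_functions_eq)
  moreover have "exactly_learns n (2 * m) E (fourier_sparse n k) (2 / 3)"
    using E(2) by (simp add: exactly_learns_def example_basis_def fourier_sparse_eq uniform_example_eq)
  ultimately show "\<exists>T E. real T \<le> 170498 * real k powr (3 / 2) * (log 2 (real k))\<^sup>2 \<and>
      quantum_learner n T E \<and> exactly_learns n T E (fourier_sparse n k) (2 / 3)"
    using T by blast
qed simp

end
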